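(* Let $h$ be a boundary function. Suppose that either (1) (Poly-$R_1$) and $\mathbf{HK}^h_B$ hold, or (2) (Poly-$\infty$) and $\mathbf{HK}^h_U$ hold. Then, for $(x,y)\in D\times D$ with $x\ne y$, $$J(x,y)\simeq \frac{C_0\,\mathcal{B}^*_h(x,y)}{V(x,\rho(x,y))\,\Psi(\rho(x,y))}+h(\Phi(\rho(x,y)),x,y)\,\frac{w\big(\Phi(\rho(x,y))\big)}{V(x,\rho(x,y))},$$ where $\mathcal{B}^*_h(x,y):=\int_0^{\Phi(\rho(x,y))}h(s,x,y)\,w(s)\,ds$, and $J(x,y)=\int_0^\infty p_D(s,x,y)\,\nu(ds)$ is the jump kernel of the subordinate process $X_t=Y^D_{S_t}$.
   Context: Notation: $a\wedge b=\min$, $a\vee b=\max$; $f\simeq g$ means $c_1g\le f\le c_2g$ on the specified range for some constants $c_1,c_2>0$. Quotients $c/0$ with $c>0$ are $+\infty$. Subordinator: $S=(S_t)_{t\ge0}$ is a driftless subordinator (non-decreasing pure-jump Lévy process, $S_0=0$) with Laplace exponent $\phi(\lambda)=-\log\mathbb{E}e^{-\lambda S_1}=\int_0^\infty(1-e^{-\lambda s})\nu(ds)$ and $w(r):=\nu(r,\infty)$. Condition (Poly-$R_1$), $R_1\in(0,\infty]$: there are constants $c_1,c_2>0$, $\beta_2\ge\beta_1>0$ with $c_1(R/r)^{\beta_1}\le w(r)/w(R)\le c_2(R/r)^{\beta_2}$ for all $0<r\le R<R_1$. (Poly-$\infty$) is the case $R_1=\infty$. Space and process: $(E,\rho)$ is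 a locally compact separable metric space in which all bounded closed sets are compact, $m$ (also written $dy$) is a positive Radon measure on $E$ with full support, $B(x,r)$ is the open ball, $V(x,r)=m(B(x,r))$. There are $R_E\in(0,\infty]$ and $d_2\ge d_1>0$ such that for every $a\ge1$ there is $C_V\ge1$ with $C_V^{-1}(R/r)^{d_1}\le V(x,R)/V(x,r)\le C_V(R/r)^{d_2}$ for all $x\in E$, $0<r\le R<aR_E$. $D\subset E$ is a proper open subset, $\delta_D(x)=\rho(x,E\setminus D)$. $Y^D$ is a Hunt process in $D$ independent of $S$ whose semigroup has a density (heat kernel) $p_D(t,x,y)$ with respect to $m$. Scale functions: $\Phi,\Psi:[0,\infty)\to[0,\infty)$ are strictly increasing, $\Psi\ge\Phi$, and for some constants $\alpha_1,\dots,\alpha_4,c_1,\dots,c_4>0$ and all $R\ge r>0$: $c_1(R/r)^{\alpha_1}\le\Phi(R)/\Phi(r)\le c_2(R/r)^{\alpha_2}$ and $c_3(R/r)^{\alpha_3}\le\Psi(R)/\Psi(r)\le c_4(R/r)^{\alpha_4}$. If $D$ is unbounded, $\Phi(\mathrm{diam}(D))$ is read as $\infty$. Boundary function: $h:(0,\infty)\times D\times D\to[0,1]$ such that (H1) $s\mapsto h(s,x,y)$ is non-increasing for all $x,y\in D$; (H2) there are $c_1>0$, $\gamma\ge0$ with $s^\gamma h(s,x,y)\le c_1t^\gamma h(t,x,y)$ for $0<s\le t<4\Phi(\mathrm{diam}(D))+1$, $x,y\in D$. Heat kernel conditions: for $C_0\in\{0,1\}$ and $c>0$ put $$I_{c}(t,x,y)=\frac1{V(x,\Phi^{-1}(t))}\wedge\Big(\frac{C_0t}{V(x,\rho(x,y))\Psi(\rho(x,y))}+\frac1{V(x,\Phi^{-1}(t))}\exp\Big(-\frac{c\,\rho(x,y)^2}{\Phi^{-1}(t)^2}\Big)\Big)$$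 (the first summand is absent if $C_0=0$). $\mathbf{HK}^h_B$: $D$ is bounded; (i) there are $C_0\in\{0,1\}$ and $c_1,c_2,c_3,c_4>0$ with $c_1h(t,x,y)I_{c_2}(t,x,y)\le p_D(t,x,y)\le c_3h(t,x,y)I_{c_4}(t,x,y)$ for all $(t,x,y)\in(0,1]\times D\times D$; (ii) there is $\lambda_D>0$ with $p_D(t,x,y)\simeq e^{-\lambda_Dt}h(1,x,y)$ for $(t,x,y)\in[1,\infty)\times D\times D$. $\mathbf{HK}^h_U$: $R_E=\infty$ and the two-sided estimate in (i) holds for all $(t,x,y)\in(0,\infty)\times D\times D$. The constant $C_0$ in the claim is the one in these conditions. Standing convention: when (Poly-$R_1$) and $\mathbf{HK}^h_B$ hold, $\Phi$ is normalized (by multiplication by a constant) so that $\Phi(\mathrm{diam}(D))<R_1/8$. *)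

theory Defs
  imports "HOL-Probability.Probability"
begin

section \<open>The state space\<close>

definition radon_measure :: "'a::topological_space measure \<Rightarrow> bool" where
  "radon_measure m \<longleftrightarrow>
     sets m = sets borel \<and>
     (\<forall>K. compact K \<longrightarrow> emeasure m K < \<infinity>) \<and>
     (\<forall>A\<in>sets borel. emeasure m A = (INF U\<in>{U. open U \<and> A \<subseteq> U}. emeasure m U)) \<and>
     (\<forall>U. open U \<longrightarrow> emeasure m U = (SUP K\<in>{K. compact K \<and> K \<subseteq> U}. emeasure m K))"

definition full_support :: "'a::topological_space measure \<Rightarrow> bool" where
  "full_support m \<longleftrightarrow> (\<forall>U. open U \<and> U \<noteq> {} \<longrightarrow> 0 < emeasure m U)"

definition vol :: "'a::metric_space measure \<Rightarrow> 'a \<Rightarrow> real \<Rightarrow> real" where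
  "vol m x r = measure m (ball x r)"

definition volume_doubling :: "'a::metric_space measure \<Rightarrow> ereal \<Rightarrow> bool" where
  "volume_doubling m R\<^sub>E \<longleftrightarrow>
     (\<exists>d\<^sub>1 d\<^sub>2. 0 < d\<^sub>1 \<and> d\<^sub>1 \<le> d\<^sub>2 \<and>
       (\<forall>a\<ge>1. \<exists>C\<ge>1. \<forall>x r R. 0 < r \<and> r \<le> R \<and> ereal R < ereal a * R\<^sub>E \<longrightarrow>
          inverse C * (R / r) powr d\<^sub>1 \<le> vol m x R / vol m x r \<and>
          vol m x R / vol m x r \<le> C * (R / r) powr d\<^sub>2))"

section \<open>Subordinators\<close>

definition levy_measure :: "real measure \<Rightarrow> bool" where
  "levy_measure \<nu> \<longleftrightarrow>
     sets \<nu> = sets borel \<and> emeasure \<nu> {..0} = 0 \<and>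
     (\<integral>\<^sup>+ s. ennreal (min 1 s) \<partial>\<nu>) < \<infinity>"

definition tail :: "real measure \<Rightarrow> real \<Rightarrow> real" where
  "tail \<nu> r = measure \<nu> {r<..}"

definition subordinator :: "'w measure \<Rightarrow> (real \<Rightarrow> 'w \<Rightarrow> real) \<Rightarrow> bool" where
  "subordinator M S \<longleftrightarrow>
     prob_space M \<and>
     (\<forall>t\<ge>0. S t \<in> borel_measurable M) \<and>
     (AE \<omega> in M. S 0 \<omega> = 0 \<and> mono_on {0..} (\<lambda>t. S t \<omega>) \<and>
        (\<forall>t\<ge>0. continuous (at_right t) (\<lambda>t. S t \<omega>))) \<and>
     (\<forall>s\<ge>0. \<forall>t\<ge>0. distr M borel (\<lambda>\<omega>. S (s + t) \<omega> - S s \<omega>) = distr M borel (S t)) \<and>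
     (\<forall>(t::nat \<Rightarrow> real) n. 0 \<le> t 0 \<and> mono t \<longrightarrow>
        prob_space.indep_vars M (\<lambda>_. borel) (\<lambda>i \<omega>. S (t (Suc i)) \<omega> - S (t i) \<omega>) {..<n})"

definition laplace_exponent :: "'w measure \<Rightarrow> (real \<Rightarrow> 'w \<Rightarrow> real) \<Rightarrow> real \<Rightarrow> real" where
  "laplace_exponent M S l = - ln (\<integral>\<omega>. exp (- l * S 1 \<omega>) \<partial>M)"

text \<open>Absence of a drift means that the Laplace exponent has no linear term besides the
  Levy integral.\<close>

definition driftless_subordinator :: "'w measure \<Rightarrow> (real \<Rightarrow> 'w \<Rightarrow> real) \<Rightarrow> real measure \<Rightarrow> bool" where
  "driftless_subordinator M S \<nu> \<longleftrightarrow>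
     subordinator M S \<and> levy_measure \<nu> \<and>
     (\<forall>l\<ge>0. laplace_exponent M S l = (\<integral>s. (1 - exp (- l * s)) \<partial>\<nu>))"

definition poly_tail :: "ereal \<Rightarrow> real measure \<Rightarrow> bool" where
  "poly_tail R\<^sub>1 \<nu> \<longleftrightarrow>
     (\<exists>c\<^sub>1 c\<^sub>2 \<beta>\<^sub>1 \<beta>\<^sub>2. 0 < c\<^sub>1 \<and> 0 < c\<^sub>2 \<and> 0 < \<beta>\<^sub>1 \<and> \<beta>\<^sub>1 \<le> \<beta>\<^sub>2 \<and>
       (\<forall>r R. 0 < r \<and> r \<le> R \<and> ereal R < R\<^sub>1 \<longrightarrow>
          c\<^sub>1 * (R / r) powr \<beta>\<^sub>1 \<le> tail \<nu> r / tail \<nu> R \<and>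
          tail \<nu> r / tail \<nu> R \<le> c\<^sub>2 * (R / r) powr \<beta>\<^sub>2))"

section \<open>Hunt processes and heat kernels\<close>

text \<open>The state space \<open>D\<close> with the cemetery \<open>None\<close> adjoined as the point at infinity
  (an isolated point if \<open>D\<close> is compact), and its Borel \<open>\<sigma>\<close>-algebra.\<close>

abbreviation cemetery_ext :: "'a::topological_space set \<Rightarrow> 'a option topology" where
  "cemetery_ext D \<equiv> Alexandroff_compactification (top_of_set D)"

definition borel_of_topology :: "'b topology \<Rightarrow> 'b measure" where
  "borel_of_topology T = sigma (topspace T) {U. openin T U}"

text \<open>Time runs through \<open>[0,\<infinity>]\<close>, with \<open>Y \<infinity>\<close> being the cemetery. The last conjuncts
  are the strong Markov property and the quasi-left-continuity with respect to a right-continuous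
  filtration \<open>F\<close> to which \<open>Y\<close> is adapted.\<close>

definition hunt_process ::
  "'a::topological_space set \<Rightarrow> 'w measure \<Rightarrow> ('a option \<Rightarrow> 'w measure) \<Rightarrow>
    (ennreal \<Rightarrow> 'w \<Rightarrow> 'a option) \<Rightarrow> bool" where
  "hunt_process D W P Y \<longleftrightarrow>
     (let T = cemetery_ext D; B = borel_of_topology T; \<Omega> = space W in
       (\<forall>x\<in>topspace T. prob_space (P x) \<and> sets (P x) = sets W) \<and>
       (\<forall>t. Y t \<in> measurable W B) \<and>
       (\<forall>t. \<forall>A\<in>sets B. (\<lambda>x. measure (P x) {\<omega>\<in>\<Omega>. Y t \<omega> \<in> A}) \<in> borel_measurable B) \<and>
       (\<forall>x\<in>topspace T. AE \<omega> in P x. Y 0 \<omega> = x) \<and>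
       (\<forall>t. AE \<omega> in P None. Y t \<omega> = None) \<and>
       (\<forall>\<omega>\<in>\<Omega>. Y \<infinity> \<omega> = None \<and> (\<forall>t\<ge>Inf {s. Y s \<omega> = None}. Y t \<omega> = None)) \<and>
       (\<exists>\<theta>. \<forall>t<\<infinity>. \<forall>\<omega>\<in>\<Omega>. \<theta> t \<omega> \<in> \<Omega> \<and> (\<forall>s. Y s (\<theta> t \<omega>) = Y (t + s) \<omega>)) \<and>
       (\<forall>\<omega>\<in>\<Omega>. \<forall>t<\<infinity>. limitin T (\<lambda>s. Y s \<omega>) (Y t \<omega>) (at_right t) \<and>
          (0 < t \<longrightarrow> (\<exists>l. limitin T (\<lambda>s. Y s \<omega>) l (at_left t)))) \<and>
       (\<exists>F. filtration \<Omega> F \<and>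
          (\<forall>t. sets (F t) \<subseteq> sets W \<and> Y t \<in> measurable (F t) B) \<and>
          (\<forall>t<\<infinity>. sets (F t) = (\<Inter>u\<in>{t<..}. sets (F u))) \<and>
          (\<forall>\<sigma>. stopping_time F \<sigma> \<longrightarrow>
             (\<forall>x\<in>topspace T. \<forall>s. \<forall>A\<in>sets B. AE \<omega> in P x.
                real_cond_exp (P x) (filtration.pre_sigma \<Omega> F \<sigma>)
                  (indicator {\<omega>\<in>\<Omega>. Y (\<sigma> \<omega> + s) \<omega> \<in> A}) \<omega> =
                measure (P (Y (\<sigma> \<omega>) \<omega>)) {\<omega>'\<in>\<Omega>. Y s \<omega>' \<in> A})) \<and>
          (\<forall>\<sigma>s \<sigma>. (\<forall>n. stopping_time F (\<sigma>s n)) \<and>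
             (\<forall>\<omega>\<in>\<Omega>. incseq (\<lambda>n. \<sigma>s n \<omega>) \<and> (\<lambda>n. \<sigma>s n \<omega>) \<longlonglongrightarrow> \<sigma> \<omega>) \<longrightarrow>
             (\<forall>x\<in>topspace T. AE \<omega> in P x. \<sigma> \<omega> < \<infinity> \<longrightarrow>
                limitin T (\<lambda>n. Y (\<sigma>s n \<omega>) \<omega>) (Y (\<sigma> \<omega>) \<omega>) sequentially))))"

definition independent_processes ::
  "'a::topological_space set \<Rightarrow> 'w measure \<Rightarrow> (ennreal \<Rightarrow> 'w \<Rightarrow> 'a option) \<Rightarrow>
    (real \<Rightarrow> 'w \<Rightarrow> real) \<Rightarrow> bool" where
  "independent_processes D M Y S \<longleftrightarrow>
     prob_space.indep_set M
       (sets (vimage_algebra (space M) (\<lambda>\<omega>. \<lambda>t\<in>UNIV. Y t \<omega>)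
          (PiM UNIV (\<lambda>_. borel_of_topology (cemetery_ext D)))))
       (sets (vimage_algebra (space M) (\<lambda>\<omega>. \<lambda>t\<in>{0..}. S t \<omega>) (PiM {0..} (\<lambda>_. borel))))"

text \<open>The measurability of \<open>p\<close> is only what is needed for the integrals over \<open>y\<close> (semigroup)
  and over \<open>t\<close> (jump kernel) to make sense.\<close>

definition heat_kernel ::
  "'a::topological_space set \<Rightarrow> 'a measure \<Rightarrow> 'w measure \<Rightarrow> ('a option \<Rightarrow> 'w measure) \<Rightarrow>
    (ennreal \<Rightarrow> 'w \<Rightarrow> 'a option) \<Rightarrow> (real \<Rightarrow> 'a \<Rightarrow> 'a \<Rightarrow> real) \<Rightarrow> bool" where
  "heat_kernel D m W P Y p \<longleftrightarrow>
     (\<forall>t>0. \<forall>x\<in>D. \<forall>y\<in>D. 0 \<le> p t x y) \<and>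
     (\<forall>t>0. \<forall>x\<in>D. p t x \<in> borel_measurable (restrict_space borel D)) \<and>
     (\<forall>x\<in>D. \<forall>y\<in>D. (\<lambda>t. p t x y) \<in> borel_measurable (restrict_space borel {0<..})) \<and>
     (\<forall>t>0. \<forall>x\<in>D. \<forall>A\<in>sets borel. A \<subseteq> D \<longrightarrow>
        emeasure (P (Some x)) {\<omega>\<in>space W. Y (ennreal t) \<omega> \<in> Some ` A} =
        (\<integral>\<^sup>+ y\<in>A. ennreal (p t x y) \<partial>m))"

section \<open>Scale functions and boundary functions\<close>

definition weak_scaling :: "(real \<Rightarrow> real) \<Rightarrow> bool" where
  "weak_scaling f \<longleftrightarrow>
     (\<exists>\<alpha> \<alpha>' c c'. 0 < \<alpha> \<and> 0 < \<alpha>' \<and> 0 < c \<and> 0 < c' \<and>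
       (\<forall>r R. 0 < r \<and> r \<le> R \<longrightarrow>
          c * (R / r) powr \<alpha> \<le> f R / f r \<and> f R / f r \<le> c' * (R / r) powr \<alpha>'))"

definition scale_functions :: "(real \<Rightarrow> real) \<Rightarrow> (real \<Rightarrow> real) \<Rightarrow> bool" where
  "scale_functions \<Phi> \<Psi> \<longleftrightarrow>
     strict_mono_on {0..} \<Phi> \<and> strict_mono_on {0..} \<Psi> \<and>
     (\<forall>r\<ge>0. 0 \<le> \<Phi> r \<and> \<Phi> r \<le> \<Psi> r) \<and>
     weak_scaling \<Phi> \<and> weak_scaling \<Psi>"

text \<open>Scale functions need not be continuous, so the inverse is the generalized one. By strict
  monotonicity it is the ordinary inverse on the range of \<open>\<Phi>\<close>, and replacing \<open><\<close> by \<open>\<le>\<close>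
  gives the same function.\<close>

definition scale_inv :: "(real \<Rightarrow> real) \<Rightarrow> real \<Rightarrow> real" where
  "scale_inv \<Phi> t = Inf {s. 0 \<le> s \<and> t < \<Phi> s}"

definition scale_diam :: "(real \<Rightarrow> real) \<Rightarrow> 'a::metric_space set \<Rightarrow> ereal" where
  "scale_diam \<Phi> D = (if bounded D then ereal (\<Phi> (diameter D)) else \<infinity>)"

definition boundary_function ::
  "'a::metric_space set \<Rightarrow> (real \<Rightarrow> real) \<Rightarrow> (real \<Rightarrow> 'a \<Rightarrow> 'a \<Rightarrow> real) \<Rightarrow> bool" where
  "boundary_function D \<Phi> h \<longleftrightarrow>
     (\<forall>s>0. \<forall>x\<in>D. \<forall>y\<in>D. 0 \<le> h s x y \<and> h s x y \<le> 1) \<and>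
     (\<forall>x\<in>D. \<forall>y\<in>D. \<forall>s t. 0 < s \<and> s \<le> t \<longrightarrow> h t x y \<le> h s x y) \<and>
     (\<exists>c\<^sub>1>0. \<exists>\<gamma>\<ge>0. \<forall>s t. 0 < s \<and> s \<le> t \<and> ereal t < 4 * scale_diam \<Phi> D + 1 \<longrightarrow>
        (\<forall>x\<in>D. \<forall>y\<in>D. s powr \<gamma> * h s x y \<le> c\<^sub>1 * t powr \<gamma> * h t x y))"

section \<open>Heat kernel conditions\<close>

text \<open>At \<open>x = y\<close> the quotient by \<open>vol m x 0 * \<Psi> 0 = 0\<close> is \<open>0\<close> here instead of \<open>\<infinity>\<close>. This does
  not change the value: the exponential is \<open>1\<close>, so that the minimum is \<open>1 / vol m x (scale_inv \<Phi> t)\<close>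
  either way.\<close>

definition HK_form ::
  "'a::metric_space measure \<Rightarrow> (real \<Rightarrow> real) \<Rightarrow> (real \<Rightarrow> real) \<Rightarrow> real \<Rightarrow> real \<Rightarrow>
    real \<Rightarrow> 'a \<Rightarrow> 'a \<Rightarrow> real" where
  "HK_form m \<Phi> \<Psi> C\<^sub>0 c t x y =
     min (1 / vol m x (scale_inv \<Phi> t))
       (C\<^sub>0 * t / (vol m x (dist x y) * \<Psi> (dist x y)) +
        1 / vol m x (scale_inv \<Phi> t) * exp (- c * (dist x y)\<^sup>2 / (scale_inv \<Phi> t)\<^sup>2))"

definition HK_estimate ::
  "'a::metric_space set \<Rightarrow> 'a measure \<Rightarrow> (real \<Rightarrow> real) \<Rightarrow> (real \<Rightarrow> real) \<Rightarrow>
    (real \<Rightarrow> 'a \<Rightarrow> 'a \<Rightarrow> real) \<Rightarrow> (real \<Rightarrow> 'a \<Rightarrow> 'a \<Rightarrow> real) \<Rightarrow> real \<Rightarrow> real set \<Rightarrow> bool" where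
  "HK_estimate D m \<Phi> \<Psi> h p C\<^sub>0 I \<longleftrightarrow>
     (\<exists>c\<^sub>1>0. \<exists>c\<^sub>2>0. \<exists>c\<^sub>3>0. \<exists>c\<^sub>4>0. \<forall>t\<in>I. \<forall>x\<in>D. \<forall>y\<in>D.
        c\<^sub>1 * h t x y * HK_form m \<Phi> \<Psi> C\<^sub>0 c\<^sub>2 t x y \<le> p t x y \<and>
        p t x y \<le> c\<^sub>3 * h t x y * HK_form m \<Phi> \<Psi> C\<^sub>0 c\<^sub>4 t x y)"

definition HK_B ::
  "'a::metric_space set \<Rightarrow> 'a measure \<Rightarrow> (real \<Rightarrow> real) \<Rightarrow> (real \<Rightarrow> real) \<Rightarrow>
    (real \<Rightarrow> 'a \<Rightarrow> 'a \<Rightarrow> real) \<Rightarrow> (real \<Rightarrow> 'a \<Rightarrow> 'a \<Rightarrow> real) \<Rightarrow> real \<Rightarrow> bool" where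
  "HK_B D m \<Phi> \<Psi> h p C\<^sub>0 \<longleftrightarrow>
     bounded D \<and>
     HK_estimate D m \<Phi> \<Psi> h p C\<^sub>0 {0<..1} \<and>
     (\<exists>\<mu>>0. \<exists>c\<^sub>1>0. \<exists>c\<^sub>2>0. \<forall>t\<ge>1. \<forall>x\<in>D. \<forall>y\<in>D.
        c\<^sub>1 * (exp (- \<mu> * t) * h 1 x y) \<le> p t x y \<and>
        p t x y \<le> c\<^sub>2 * (exp (- \<mu> * t) * h 1 x y))"

definition HK_U ::
  "'a::metric_space set \<Rightarrow> 'a measure \<Rightarrow> ereal \<Rightarrow> (real \<Rightarrow> real) \<Rightarrow> (real \<Rightarrow> real) \<Rightarrow>
    (real \<Rightarrow> 'a \<Rightarrow> 'a \<Rightarrow> real) \<Rightarrow> (real \<Rightarrow> 'a \<Rightarrow> 'a \<Rightarrow> real) \<Rightarrow> real \<Rightarrow> bool" where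
  "HK_U D m R\<^sub>E \<Phi> \<Psi> h p C\<^sub>0 \<longleftrightarrow> R\<^sub>E = \<infinity> \<and> HK_estimate D m \<Phi> \<Psi> h p C\<^sub>0 {0<..}"

section \<open>The jump kernel\<close>

text \<open>The jump kernel of the subordinate process \<open>X\<^sub>t = Y\<close> at time \<open>S\<^sub>t\<close>; like \<open>B_star\<close> it takes
  values in \<open>[0,\<infinity>]\<close>, so that no convergence of the integral is presupposed.\<close>

definition jump_kernel :: "(real \<Rightarrow> 'a \<Rightarrow> 'a \<Rightarrow> real) \<Rightarrow> real measure \<Rightarrow> 'a \<Rightarrow> 'a \<Rightarrow> ennreal" where
  "jump_kernel p \<nu> x y = (\<integral>\<^sup>+ s\<in>{0<..}. ennreal (p s x y) \<partial>\<nu>)"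

definition B_star ::
  "(real \<Rightarrow> real) \<Rightarrow> real measure \<Rightarrow> (real \<Rightarrow> 'a::metric_space \<Rightarrow> 'a \<Rightarrow> real) \<Rightarrow> 'a \<Rightarrow> 'a \<Rightarrow> ennreal" where
  "B_star \<Phi> \<nu> h x y = (\<integral>\<^sup>+ s\<in>{0<..<\<Phi> (dist x y)}. ennreal (h s x y * tail \<nu> s) \<partial>lborel)"

end

theory Submission
  imports Defs
begin

text \<open>
  Write \<open>r = dist x y\<close>, \<open>T = \<Phi> r\<close>, \<open>V = vol m x r\<close> and \<open>w\<close> for the tail of \<open>\<nu>\<close>. The jump kernel
  integrates \<open>p s x y\<close> against \<open>\<nu>\<close>, and the time \<open>T\<close> at which the process typically covers the
  distance \<open>r\<close> separates two regimes.

  After \<open>T\<close> the kernel is at most of order \<open>h T x y / V\<close>, because \<open>h\<close> decreases in time and the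
  volume at the diffusive radius is at least \<open>V\<close>; this contributes \<open>h T x y * w T / V\<close>. Before \<open>T\<close> the
  kernel is a jump part of order \<open>C\<^sub>0 * s * h s x y / (V * \<Psi> r)\<close> plus a Gaussian part. The Gaussian
  part decays, relative to its size \<open>h T x y / V\<close> at time \<open>T\<close>, faster than any power of \<open>s / T\<close>: the
  doubling properties of \<open>h\<close>, of the volume and of \<open>\<Phi>\<close> cost only powers of
  \<open>r / scale_inv \<Phi> s\<close>, which the Gaussian absorbs (\<open>upper_profile_heat_kernel\<close>). Since \<open>w\<close> grows at
  most polynomially at \<open>0\<close>, its integral is again of order \<open>h T x y * w T / V\<close>
  (\<open>tail_power_moment\<close>).

  For the jump part, the integral of \<open>s * h s x y\<close> against \<open>\<nu>\<close> over \<open>(0,T]\<close> has to be comparable to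
  the integral of \<open>h s x y * w s\<close> over \<open>(0,T)\<close>. Both directions exchange the order of integration
  and use that \<open>h\<close> decreases; the harder one also uses that some fixed factor \<open>M\<close> satisfies
  \<open>\<nu> (s/M, s] \<ge> w s\<close>, by the lower scaling of \<open>w\<close> (\<open>weighted_moment_le_tail_integral\<close>,
  \<open>tail_integral_le_weighted_moment\<close>). The same shell, at \<open>s = T\<close>, gives the lower bound
  \<open>h T x y * w T / V\<close>, since the Gaussian factor is bounded below there.

  On a bounded domain the kernel at times \<open>s > 1\<close> is given by an exponential decay instead.
  The same pointwise bounds then hold with other constants: for the upper one, \<open>V\<close> and \<open>T\<close> are bounded
  above over the domain; the lower one is only claimed for \<open>s \<le> T\<close>, so that \<open>r\<close> is at least the
  diffusive radius at time \<open>1\<close>, and \<open>V\<close> is bounded below (\<open>upper_profile_large_times\<close>,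
  \<open>lower_profile_large_times\<close>).
\<close>

section \<open>Levy measures with polynomial tails\<close>

lemma levy_sets: "levy_measure \<nu> \<Longrightarrow> sets \<nu> = sets borel"
  by (simp add: levy_measure_def)

text \<open>The integrability of \<open>min 1 s\<close> bounds the mass beyond \<open>r\<close>, as the integrand
  is at least \<open>min 1 r\<close> there.\<close>

lemma levy_tail_finite:
  assumes "levy_measure \<nu>" "0 < r"
  shows "emeasure \<nu> {r<..} < \<infinity>"
proof -
  note [measurable_cong] = levy_sets[OF assms(1)]
  let ?c = "min 1 r"
  have "ennreal ?c * emeasure \<nu> {r<..} = (\<integral>\<^sup>+ s. ennreal ?c * indicator {r<..} s \<partial>\<nu>)"
    by (subst nn_integral_cmult_indicator) (auto simp: levy_sets[OF assms(1)])
  also have "\<dots> \<le> (\<integral>\<^sup>+ s. ennreal (min 1 s) \<partial>\<nu>)"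
    by (intro nn_integral_mono) (auto simp: indicator_def intro!: ennreal_leI)
  also have "\<dots> < \<infinity>" using assms(1) by (simp add: levy_measure_def)
  finally have "ennreal ?c * emeasure \<nu> {r<..} < \<infinity>" .
  then show ?thesis using assms(2)
    by (auto simp: ennreal_mult_less_top top.not_eq_extremum)
qed

lemma levy_emeasure_tail:
  assumes "levy_measure \<nu>" "0 < r"
  shows "emeasure \<nu> {r<..} = ennreal (tail \<nu> r)"
  using levy_tail_finite[OF assms] by (simp add: tail_def emeasure_eq_ennreal_measure)

lemma levy_sigma_finite:
  assumes "levy_measure \<nu>"
  shows "sigma_finite_measure \<nu>"
proof
  let ?A = "insert {..0} ((\<lambda>n. {1 / real (Suc n)<..}) ` UNIV)"
  have "\<Union>?A = (UNIV :: real set)"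
  proof -
    have "x \<in> \<Union>?A" for x :: real
    proof (cases "x \<le> 0")
      case False
      then obtain n where "1 / real (Suc n) < x" using nat_approx_posE[of x] by (auto simp: not_le)
      then show ?thesis by auto
    qed auto
    then show ?thesis by blast
  qed
  moreover have "\<forall>a\<in>?A. emeasure \<nu> a \<noteq> \<infinity>"
    using levy_tail_finite[OF assms] assms by (auto simp: levy_measure_def top.not_eq_extremum)
  moreover have "space \<nu> = UNIV" using sets_eq_imp_space_eq[OF levy_sets[OF assms]] by simp
  ultimately show "\<exists>A. countable A \<and> A \<subseteq> sets \<nu> \<and> \<Union> A = space \<nu> \<and> (\<forall>a\<in>A. emeasure \<nu> a \<noteq> \<infinity>)"
    by (intro exI[of _ ?A]) (auto simp: levy_sets[OF assms])
qed

lemma tail_antimono: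
  assumes "levy_measure \<nu>" "0 < r" "r \<le> R"
  shows "tail \<nu> R \<le> tail \<nu> r"
proof -
  have "emeasure \<nu> {R<..} \<le> emeasure \<nu> {r<..}"
    using assms by (intro emeasure_mono) (auto simp: levy_sets)
  then show ?thesis using assms by (simp add: levy_emeasure_tail tail_def)
qed

lemma levy_interval:
  assumes "levy_measure \<nu>" "0 < r" "r \<le> R"
  shows "emeasure \<nu> {r<..R} = ennreal (tail \<nu> r - tail \<nu> R)"
proof -
  have "{r<..R} = {r<..} - {R<..}" using assms by auto
  then have "emeasure \<nu> {r<..R} = emeasure \<nu> {r<..} - emeasure \<nu> {R<..}"
    using assms levy_tail_finite[OF assms(1), of R]
    by (simp only:) (rule emeasure_Diff, auto simp: levy_sets)
  then show ?thesis using assms by (simp add: levy_emeasure_tail ennreal_minus tail_def)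
qed

text \<open>A vanishing tail would make the quotient in the lower scaling condition \<open>0\<close>.\<close>

lemma poly_tail_positive:
  assumes "poly_tail R\<^sub>1 \<nu>" "0 < R" "ereal R < R\<^sub>1"
  shows "0 < tail \<nu> R"
proof -
  obtain c \<beta> where "0 < c" "\<forall>r R. 0 < r \<and> r \<le> R \<and> ereal R < R\<^sub>1 \<longrightarrow> c * (R / r) powr \<beta> \<le> tail \<nu> r / tail \<nu> R"
    using assms(1) unfolding poly_tail_def by blast
  then have "c * (R / R) powr \<beta> \<le> tail \<nu> R / tail \<nu> R" "0 < c" using assms by blast+
  then have "tail \<nu> R \<noteq> 0" using assms by auto
  then show ?thesis by (simp add: tail_def zero_less_measure_iff)
qed

text \<open>As the lower scaling exponent is positive, some fixed shrinking factor \<open>M\<close> puts at least \<open>w(s)\<close> of mass on the shell from \<open>s / M\<close> to \<open>s\<close>. So the shell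
  just below a scale carries at least as much mass as everything above it, and lower bounds of the
  jump kernel can be drawn from times up to that scale.\<close>

lemma poly_tail_halving:
  assumes "poly_tail R\<^sub>1 \<nu>"
  shows "\<exists>M>1. \<forall>s>0. ereal s < R\<^sub>1 \<longrightarrow> 2 * tail \<nu> s \<le> tail \<nu> (s / M)"
proof -
  obtain c \<beta> where c: "0 < c" "0 < \<beta>" and
    *: "\<And>r R. 0 < r \<Longrightarrow> r \<le> R \<Longrightarrow> ereal R < R\<^sub>1 \<Longrightarrow> c * (R / r) powr \<beta> \<le> tail \<nu> r / tail \<nu> R"
    using assms(1) unfolding poly_tail_def by blast
  define M where "M = max 2 ((2 / c) powr (1 / \<beta>))"
  have M: "1 < M" "2 / c \<le> M powr \<beta>"
  proof -
    have "2 / c = ((2 / c) powr (1 / \<beta>)) powr \<beta>" using c by (simp add: powr_powr)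
    also have "\<dots> \<le> M powr \<beta>" using c by (intro powr_mono2) (auto simp: M_def)
    finally show "2 / c \<le> M powr \<beta>" .
  qed (simp add: M_def)
  have "2 * tail \<nu> s \<le> tail \<nu> (s / M)" if "0 < s" "ereal s < R\<^sub>1" for s
  proof -
    have "2 \<le> c * M powr \<beta>" using M c by (simp add: field_simps)
    also have "\<dots> \<le> tail \<nu> (s / M) / tail \<nu> s"
      using *[of "s / M" s] that M by (simp add: field_simps)
    finally show ?thesis using poly_tail_positive[OF assms that] by (simp add: field_simps)
  qed
  then show ?thesis using M(1) by (intro exI[of _ M]) auto
qed

lemma poly_tail_upper:
  assumes "poly_tail R\<^sub>1 \<nu>"
  shows "\<exists>c>0. \<exists>\<beta>>0. \<forall>r R. 0 < r \<longrightarrow> r \<le> R \<longrightarrow> ereal R < R\<^sub>1 \<longrightarrow>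
    tail \<nu> r \<le> c * (R / r) powr \<beta> * tail \<nu> R"
proof -
  obtain c \<beta>1 \<beta> where c: "0 < c" "0 < \<beta>1" "\<beta>1 \<le> \<beta>" and
    *: "\<And>r R. 0 < r \<Longrightarrow> r \<le> R \<Longrightarrow> ereal R < R\<^sub>1 \<Longrightarrow> tail \<nu> r / tail \<nu> R \<le> c * (R / r) powr \<beta>"
    using assms(1) unfolding poly_tail_def by metis
  have "tail \<nu> r \<le> c * (R / r) powr \<beta> * tail \<nu> R" if "0 < r" "r \<le> R" "ereal R < R\<^sub>1" for r R
    using *[OF that] poly_tail_positive[OF assms, of R] that by (simp add: field_simps)
  moreover have "0 < c" "0 < \<beta>" using c by auto
  ultimately show ?thesis by (intro exI[of _ c] conjI exI[of _ \<beta>]) auto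
qed

section \<open>Moments of a Levy measure as integrals of its tail\<close>

text \<open>Boundary functions are monotone, hence measurable, in time; the value \<open>1\<close> on the negative
  half-line, being an upper bound, keeps the extension monotone.\<close>

lemma antimono_cutoff_measurable:
  fixes H :: "real \<Rightarrow> real"
  assumes "\<And>s t. 0 < s \<Longrightarrow> s \<le> t \<Longrightarrow> H t \<le> H s" and "\<And>s. 0 < s \<Longrightarrow> H s \<le> 1"
  shows "(\<lambda>s. if 0 < s then H s else 1) \<in> borel_measurable borel"
proof -
  have "mono (\<lambda>s. - (if 0 < s then H s else 1))"
    by (rule monoI) (use assms in auto)
  then have "(\<lambda>s. - (- (if 0 < s then H s else 1))) \<in> borel_measurable borel"
    by (intro borel_measurable_uminus borel_measurable_mono)
  then show ?thesis by simp
qed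

text \<open>As \<open>H\<close> decreases, \<open>u * H u\<close> is at most the integral of \<open>H\<close> over \<open>(0,u)\<close>; integrating
  this against \<open>\<nu>\<close> and exchanging the integrals turns the mass beyond \<open>s\<close> into \<open>w(s)\<close>.\<close>

lemma weighted_moment_le_tail_integral:
  fixes H :: "real \<Rightarrow> real"
  assumes levy: "levy_measure \<nu>"
    and anti: "\<And>s t. 0 < s \<Longrightarrow> s \<le> t \<Longrightarrow> H t \<le> H s"
    and bdd: "\<And>s. 0 < s \<Longrightarrow> 0 \<le> H s \<and> H s \<le> 1"
  shows "(\<integral>\<^sup>+ u\<in>{0<..<T}. ennreal (u * H u) \<partial>\<nu>)
    \<le> (\<integral>\<^sup>+ s\<in>{0<..<T}. ennreal (H s * tail \<nu> s) \<partial>lborel)"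
proof -
  note [measurable_cong] = levy_sets[OF levy]
  interpret \<nu>: sigma_finite_measure \<nu> by (rule levy_sigma_finite[OF levy])
  interpret pair_sigma_finite \<nu> lborel ..
  define K where "K s = (if 0 < s then H s else 1)" for s
  have K [measurable]: "K \<in> borel_measurable borel"
    unfolding K_def using antimono_cutoff_measurable[of H] anti bdd by blast
  have "(\<integral>\<^sup>+ u\<in>{0<..<T}. ennreal (u * H u) \<partial>\<nu>)
      = (\<integral>\<^sup>+ u. (\<integral>\<^sup>+ s. ennreal (H u) * indicator {0<..<T} u * indicator {0<..<u} s \<partial>lborel) \<partial>\<nu>)"
    by (intro nn_integral_cong, subst nn_integral_cmult_indicator)
       (auto simp: indicator_def ennreal_mult' mult.commute)
  also have "\<dots> \<le> (\<integral>\<^sup>+ u. (\<integral>\<^sup>+ s. ennreal (K s) * indicator {0<..<T} s * indicator {s<..} u \<partial>lborel) \<partial>\<nu>)"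
    by (intro nn_integral_mono) (auto simp: indicator_def K_def intro!: ennreal_leI anti)
  also have "\<dots> = (\<integral>\<^sup>+ s. (\<integral>\<^sup>+ u. ennreal (K s) * indicator {0<..<T} s * indicator {s<..} u \<partial>\<nu>) \<partial>lborel)"
    by (rule Fubini'[symmetric]) (simp only: indicator_def of_bool_def greaterThan_iff greaterThanLessThan_iff greaterThanAtMost_iff, measurable)
  also have "\<dots> = (\<integral>\<^sup>+ s\<in>{0<..<T}. ennreal (H s * tail \<nu> s) \<partial>lborel)"
    by (intro nn_integral_cong, subst nn_integral_cmult_indicator)
       (auto simp: indicator_def levy_sets[OF levy] levy_emeasure_tail[OF levy] K_def bdd ennreal_mult tail_def)
  finally show ?thesis .
qed

text \<open>The converse of the previous lemma. No pointwise bound in \<open>u\<close> is uniform in \<open>H\<close>: for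
  \<open>H s = min 1 (\<epsilon> / s)\<close>, the integral of \<open>H\<close> over \<open>(0,u)\<close> exceeds \<open>u * H u\<close> by a factor that is unbounded
  as \<open>\<epsilon>\<close> tends to \<open>0\<close>. Instead \<open>w(s)\<close> is first replaced by the mass of the shell from \<open>s / M\<close> to \<open>s\<close>. After the
  exchange, \<open>s\<close> only runs through \<open>[u, M u]\<close>, where \<open>H s \<le> H u\<close>.\<close>

lemma tail_integral_le_weighted_moment:
  fixes H :: "real \<Rightarrow> real"
  assumes levy: "levy_measure \<nu>"
    and anti: "\<And>s t. 0 < s \<Longrightarrow> s \<le> t \<Longrightarrow> H t \<le> H s"
    and bdd: "\<And>s. 0 < s \<Longrightarrow> 0 \<le> H s \<and> H s \<le> 1"
    and M: "1 < M" and halving: "\<And>s. 0 < s \<Longrightarrow> s < T \<Longrightarrow> 2 * tail \<nu> s \<le> tail \<nu> (s / M)"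
  shows "(\<integral>\<^sup>+ s\<in>{0<..<T}. ennreal (H s * tail \<nu> s) \<partial>lborel)
    \<le> ennreal M * (\<integral>\<^sup>+ u\<in>{0<..T}. ennreal (u * H u) \<partial>\<nu>)"
proof -
  note [measurable_cong] = levy_sets[OF levy]
  interpret \<nu>: sigma_finite_measure \<nu> by (rule levy_sigma_finite[OF levy])
  interpret pair_sigma_finite \<nu> lborel ..
  define K where "K s = (if 0 < s then H s else 1)" for s
  have K [measurable]: "K \<in> borel_measurable borel"
    unfolding K_def using antimono_cutoff_measurable[of H] anti bdd by blast
  have [measurable]: "(\<lambda>u. ennreal (u * H u) * indicator {0<..T} u) \<in> borel_measurable \<nu>"
  proof -
    have "(\<lambda>u. ennreal (u * H u) * indicator {0<..T} u) = (\<lambda>u. ennreal (u * K u) * indicator {0<..T} u)"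
      by (auto simp: K_def indicator_def)
    then show ?thesis by simp
  qed
  have "(\<integral>\<^sup>+ s\<in>{0<..<T}. ennreal (H s * tail \<nu> s) \<partial>lborel)
      \<le> (\<integral>\<^sup>+ s. (\<integral>\<^sup>+ u. ennreal (K s) * indicator {0<..<T} s * indicator {s/M<..s} u \<partial>\<nu>) \<partial>lborel)"
  proof (intro nn_integral_mono)
    fix s :: real
    show "ennreal (H s * tail \<nu> s) * indicator {0<..<T} s
      \<le> (\<integral>\<^sup>+ u. ennreal (K s) * indicator {0<..<T} s * indicator {s/M<..s} u \<partial>\<nu>)"
    proof (cases "0 < s \<and> s < T")
      case True
      then have "s / M \<le> s" using M by (simp add: field_simps)
      then have "emeasure \<nu> {s/M<..s} = ennreal (tail \<nu> (s/M) - tail \<nu> s)"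
        using M True by (intro levy_interval[OF levy]) auto
      moreover have "ennreal (tail \<nu> s) \<le> ennreal (tail \<nu> (s/M) - tail \<nu> s)"
        using halving[of s] True by (intro ennreal_leI) auto
      ultimately show ?thesis using True bdd[of s]
        by (subst nn_integral_cmult_indicator)
           (auto simp: levy_sets[OF levy] K_def ennreal_mult tail_def intro!: mult_left_mono)
    qed (auto simp: indicator_def)
  qed
  also have "\<dots> = (\<integral>\<^sup>+ u. (\<integral>\<^sup>+ s. ennreal (K s) * indicator {0<..<T} s * indicator {s/M<..s} u \<partial>lborel) \<partial>\<nu>)"
    by (rule Fubini') (simp only: indicator_def of_bool_def greaterThan_iff greaterThanLessThan_iff greaterThanAtMost_iff, measurable)
  also have "\<dots> \<le> (\<integral>\<^sup>+ u. (\<integral>\<^sup>+ s. ennreal (H u) * indicator {0<..T} u * indicator {u..M*u} s \<partial>lborel) \<partial>\<nu>)"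
  proof (intro nn_integral_mono)
    fix u s :: real
    have "0 < u" if "0 < s" "s / M < u" 
      using that M by (smt (verit) divide_pos_pos)
    then show "ennreal (K s) * indicator {0<..<T} s * indicator {s/M<..s} u
      \<le> ennreal (H u) * indicator {0<..T} u * indicator {u..M*u} s"
      using M by (auto simp: indicator_def K_def field_simps intro!: ennreal_leI anti)
  qed
  also have "\<dots> \<le> (\<integral>\<^sup>+ u. ennreal M * (ennreal (u * H u) * indicator {0<..T} u) \<partial>\<nu>)"
  proof (intro nn_integral_mono)
    fix u :: real
    show "(\<integral>\<^sup>+ s. ennreal (H u) * indicator {0<..T} u * indicator {u..M*u} s \<partial>lborel)
      \<le> ennreal M * (ennreal (u * H u) * indicator {0<..T} u)"
    proof (cases "0 < u \<and> u \<le> T")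
      case True
      then have "emeasure lborel {u..M*u} = ennreal (M*u - u)" using M by simp
      also have "\<dots> \<le> ennreal (M*u)" using True by (intro ennreal_leI) auto
      finally have "ennreal (H u) * emeasure lborel {u..M*u} \<le> ennreal (H u) * ennreal (M*u)"
        by (rule mult_left_mono) simp
      also have "\<dots> = ennreal M * ennreal (u * H u)" using True M bdd[of u]
        by (simp add: ennreal_mult[symmetric] mult_ac)
      finally show ?thesis using True by (subst nn_integral_cmult_indicator) auto
    qed (auto simp: indicator_def)
  qed
  also have "\<dots> = ennreal M * (\<integral>\<^sup>+ u\<in>{0<..T}. ennreal (u * H u) \<partial>\<nu>)"
    by (rule nn_integral_cmult) measurable
  finally show ?thesis .
qed

text \<open>Any power above the tail exponent \<open>\<beta>\<close> has a truncated moment of at most the order of the tail. With \<open>\<beta> + 1\<close> the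
  computation is elementary: the power is dominated by the integral of \<open>s powr \<beta>\<close> over \<open>(u/2, u)\<close>, and
  after the exchange of integrals \<open>s powr \<beta> * w(s)\<close> is bounded by a constant.\<close>

lemma tail_power_moment:
  assumes levy: "levy_measure \<nu>" and "0 < c" "0 < \<beta>" "0 < T"
    and upper: "\<And>r. 0 < r \<Longrightarrow> r \<le> T \<Longrightarrow> tail \<nu> r \<le> c * (T / r) powr \<beta> * tail \<nu> T"
  shows "(\<integral>\<^sup>+ u\<in>{0<..T}. ennreal ((u / T) powr (\<beta> + 1)) \<partial>\<nu>)
    \<le> ennreal (2 powr (\<beta> + 1) * c * tail \<nu> T)"
proof -
  note [measurable_cong] = levy_sets[OF levy]
  interpret \<nu>: sigma_finite_measure \<nu> by (rule levy_sigma_finite[OF levy])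
  interpret pair_sigma_finite \<nu> lborel ..
  define b where "b = 2 powr (\<beta> + 1) / T"
  have b: "0 < b" using assms by (simp add: b_def)
  have "(\<integral>\<^sup>+ u\<in>{0<..T}. ennreal ((u / T) powr (\<beta> + 1)) \<partial>\<nu>)
    \<le> (\<integral>\<^sup>+ u. (\<integral>\<^sup>+ s. ennreal (b * (s / T) powr \<beta>) * indicator {0<..T} s * indicator {s<..} u \<partial>lborel) \<partial>\<nu>)"
  proof (intro nn_integral_mono)
    fix u :: real
    show "ennreal ((u / T) powr (\<beta> + 1)) * indicator {0<..T} u
      \<le> (\<integral>\<^sup>+ s. ennreal (b * (s / T) powr \<beta>) * indicator {0<..T} s * indicator {s<..} u \<partial>lborel)"
    proof (cases "0 < u \<and> u \<le> T")
      case True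
      have *: "u / (2 * T) \<le> s / T" if "u \<le> s * 2" for s
        using that assms by (simp add: field_simps)
      have "(u / T) powr (\<beta> + 1) = b * (u / 2 / T) powr \<beta> * (u / 2)"
        using True assms by (simp add: b_def powr_add powr_divide powr_mult field_simps)
      then have "ennreal ((u / T) powr (\<beta> + 1)) = (\<integral>\<^sup>+ s. ennreal (b * (u / 2 / T) powr \<beta>) * indicator {u/2..<u} s \<partial>lborel)"
        using True b by (subst nn_integral_cmult_indicator) (auto simp: ennreal_mult[symmetric])
      also have "\<dots> \<le> (\<integral>\<^sup>+ s. ennreal (b * (s / T) powr \<beta>) * indicator {0<..T} s * indicator {s<..} u \<partial>lborel)"
        using True b assms(3) * by (intro nn_integral_mono)
          (auto simp: indicator_def intro!: ennreal_leI mult_left_mono powr_mono2)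
      finally show ?thesis using True by simp
    qed auto
  qed
  also have "\<dots> = (\<integral>\<^sup>+ s. (\<integral>\<^sup>+ u. ennreal (b * (s / T) powr \<beta>) * indicator {0<..T} s * indicator {s<..} u \<partial>\<nu>) \<partial>lborel)"
    by (rule Fubini'[symmetric]) (simp only: indicator_def of_bool_def greaterThan_iff greaterThanLessThan_iff greaterThanAtMost_iff, measurable)
  also have "\<dots> \<le> (\<integral>\<^sup>+ s. ennreal (b * c * tail \<nu> T) * indicator {0<..T} s \<partial>lborel)"
  proof (intro nn_integral_mono)
    fix s :: real
    show "(\<integral>\<^sup>+ u. ennreal (b * (s / T) powr \<beta>) * indicator {0<..T} s * indicator {s<..} u \<partial>\<nu>)
      \<le> ennreal (b * c * tail \<nu> T) * indicator {0<..T} s"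
    proof (cases "0 < s \<and> s \<le> T")
      case True
      have "b * (s / T) powr \<beta> * tail \<nu> s \<le> b * (s / T) powr \<beta> * (c * (T / s) powr \<beta> * tail \<nu> T)"
        using upper[of s] True b by (intro mult_left_mono) auto
      also have "\<dots> = b * c * tail \<nu> T" using True assms by (simp add: powr_divide)
      finally show ?thesis using True b
        by (subst nn_integral_cmult_indicator)
           (auto simp: levy_sets[OF levy] levy_emeasure_tail[OF levy] ennreal_mult[symmetric] tail_def intro!: ennreal_leI)
    qed auto
  qed
  also have "\<dots> = ennreal (2 powr (\<beta> + 1) * c * tail \<nu> T)"
    using assms b by (subst nn_integral_cmult_indicator) (auto simp: ennreal_mult[symmetric] tail_def b_def)
  finally show ?thesis .
qed


section \<open>Integrating a kernel with a jump part and a diffusive part\<close>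

text \<open>The function \<open>q\<close> stands for \<open>s \<mapsto> p s x y\<close>, \<open>H\<close> for the boundary function, and \<open>T\<close> for
  \<open>\<Phi>\<close> of the distance. Times before \<open>T\<close> contribute a jump term linear in \<open>s\<close>, whose integral is
  \<open>weighted_moment_le_tail_integral\<close>, and a diffusive term decaying at small \<open>s\<close> faster than \<open>\<nu>\<close>
  grows, which is \<open>tail_power_moment\<close>. Times after \<open>T\<close> contribute at most the tail.\<close>

lemma jump_integral_upper:
  fixes q H :: "real \<Rightarrow> real"
  assumes levy: "levy_measure \<nu>" and pos: "0 < c" "0 < \<beta>" "0 < T" "0 \<le> e" "0 \<le> v" "0 < A"
    and upper: "\<And>r. 0 < r \<Longrightarrow> r \<le> T \<Longrightarrow> tail \<nu> r \<le> c * (T / r) powr \<beta> * tail \<nu> T"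
    and anti: "\<And>s t. 0 < s \<Longrightarrow> s \<le> t \<Longrightarrow> H t \<le> H s"
    and bdd: "\<And>s. 0 < s \<Longrightarrow> 0 \<le> H s \<and> H s \<le> 1"
    and near: "\<And>s. 0 < s \<Longrightarrow> s < T \<Longrightarrow> q s \<le> A * (e * (s * H s) + v * (s / T) powr (\<beta> + 1))"
    and far: "\<And>s. T \<le> s \<Longrightarrow> q s \<le> A * v"
  shows "(\<integral>\<^sup>+ s\<in>{0<..}. ennreal (q s) \<partial>\<nu>)
    \<le> ennreal (A * (1 + 2 powr (\<beta> + 1) * c + c * 2 powr \<beta>)) *
      (ennreal e * (\<integral>\<^sup>+ s\<in>{0<..<T}. ennreal (H s * tail \<nu> s) \<partial>lborel) + ennreal (v * tail \<nu> T))"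
proof -
  note [measurable_cong] = levy_sets[OF levy]
  define K where "K s = (if 0 < s then H s else 1)" for s
  have K [measurable]: "K \<in> borel_measurable borel"
    unfolding K_def using antimono_cutoff_measurable[of H] anti bdd by blast
  have w0: "0 \<le> tail \<nu> T" by (simp add: tail_def)
  define B where "B = (\<integral>\<^sup>+ s\<in>{0<..<T}. ennreal (H s * tail \<nu> s) \<partial>lborel)"
  define C where "C = 1 + 2 powr (\<beta> + 1) * c + c * 2 powr \<beta>"
  let ?f1 = "\<lambda>s. ennreal (A * e) * (ennreal (s * K s) * indicator {0<..<T} s)"
  let ?f2 = "\<lambda>s. ennreal (A * v) * (ennreal ((s / T) powr (\<beta> + 1)) * indicator {0<..T} s)"
  \<comment> \<open>The tail is that of an open half-line, hence \<open>T / 2\<close> in order to cover the time \<open>T\<close> itself.\<close>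
  let ?f3 = "\<lambda>s. ennreal (A * v) * indicator {T/2<..} s"
  have "(\<integral>\<^sup>+ s\<in>{0<..}. ennreal (q s) \<partial>\<nu>) \<le> (\<integral>\<^sup>+ s. ?f1 s + (?f2 s + ?f3 s) \<partial>\<nu>)"
  proof (intro nn_integral_mono)
    fix s :: real
    consider "s \<le> 0" | "0 < s" "s < T" | "T \<le> s" "0 < s" by linarith
    then show "ennreal (q s) * indicator {0<..} s \<le> ?f1 s + (?f2 s + ?f3 s)"
    proof cases
      case 2
      have "ennreal (q s) \<le> ennreal ((A * e) * (s * H s) + (A * v) * (s / T) powr (\<beta> + 1))"
        using near[OF 2] by (intro ennreal_leI) (simp add: algebra_simps)
      also have "\<dots> = ?f1 s + ?f2 s"
        using 2 pos bdd[of s] by (simp add: ennreal_mult ennreal_plus K_def)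
      also have "\<dots> \<le> ?f1 s + (?f2 s + ?f3 s)" by (simp add: add.assoc[symmetric])
      finally show ?thesis using 2 by simp
    next
      case 3
      then have "ennreal (q s) \<le> ?f3 s" using far[of s] pos by (simp add: ennreal_leI)
      also have "\<dots> \<le> ?f1 s + (?f2 s + ?f3 s)" by (simp add: add.assoc[symmetric])
      finally show ?thesis using 3 by simp
    qed auto
  qed
  also have "\<dots> = (\<integral>\<^sup>+ s. ?f1 s \<partial>\<nu>) + ((\<integral>\<^sup>+ s. ?f2 s \<partial>\<nu>) + (\<integral>\<^sup>+ s. ?f3 s \<partial>\<nu>))"
    by (subst nn_integral_add, measurable, subst nn_integral_add, measurable)
  also have "\<dots> \<le> ennreal (A * e) * B +
      (ennreal (A * v) * ennreal (2 powr (\<beta> + 1) * c * tail \<nu> T) + ennreal (A * v) * ennreal (c * 2 powr \<beta> * tail \<nu> T))"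
  proof (intro add_mono)
    have "(\<integral>\<^sup>+ s. ?f1 s \<partial>\<nu>) = ennreal (A * e) * (\<integral>\<^sup>+ s\<in>{0<..<T}. ennreal (s * K s) \<partial>\<nu>)"
      by (rule nn_integral_cmult) measurable
    also have "(\<integral>\<^sup>+ s\<in>{0<..<T}. ennreal (s * K s) \<partial>\<nu>) = (\<integral>\<^sup>+ s\<in>{0<..<T}. ennreal (s * H s) \<partial>\<nu>)"
      by (intro nn_integral_cong) (simp add: K_def indicator_def)
    also have "\<dots> \<le> B"
      unfolding B_def by (rule weighted_moment_le_tail_integral[OF levy anti bdd])
    finally show "(\<integral>\<^sup>+ s. ?f1 s \<partial>\<nu>) \<le> ennreal (A * e) * B" by (simp add: mult_left_mono)
    have "(\<integral>\<^sup>+ s. ?f2 s \<partial>\<nu>) = ennreal (A * v) * (\<integral>\<^sup>+ s\<in>{0<..T}. ennreal ((s / T) powr (\<beta> + 1)) \<partial>\<nu>)"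
      by (rule nn_integral_cmult) measurable
    then show "(\<integral>\<^sup>+ s. ?f2 s \<partial>\<nu>) \<le> ennreal (A * v) * ennreal (2 powr (\<beta> + 1) * c * tail \<nu> T)"
      using tail_power_moment[OF levy pos(1-3) upper] by (simp add: mult_left_mono)
    have "(\<integral>\<^sup>+ s. ?f3 s \<partial>\<nu>) = ennreal (A * v) * ennreal (tail \<nu> (T / 2))"
      using pos by (subst nn_integral_cmult_indicator) (auto simp: levy_sets[OF levy] levy_emeasure_tail[OF levy])
    also have "\<dots> \<le> ennreal (A * v) * ennreal (c * 2 powr \<beta> * tail \<nu> T)"
      using upper[of "T / 2"] pos by (intro mult_left_mono ennreal_leI) auto
    finally show "(\<integral>\<^sup>+ s. ?f3 s \<partial>\<nu>) \<le> ennreal (A * v) * ennreal (c * 2 powr \<beta> * tail \<nu> T)" .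
  qed
  also have "\<dots> = ennreal (A * e) * B + ennreal (A * (C - 1)) * ennreal (v * tail \<nu> T)"
    using pos w0 by (simp add: C_def ennreal_mult[symmetric] ennreal_plus[symmetric] algebra_simps del: ennreal_plus)
  also have "\<dots> \<le> ennreal (A * C * e) * B + ennreal (A * C) * ennreal (v * tail \<nu> T)"
    using pos by (intro add_mono mult_right_mono ennreal_leI) (auto simp: C_def algebra_simps)
  also have "\<dots> = ennreal (A * C) * (ennreal e * B + ennreal (v * tail \<nu> T))"
    using pos by (simp add: C_def distrib_left ennreal_mult mult.assoc)
  finally show ?thesis unfolding B_def C_def .
qed

text \<open>All of the lower bound comes from times up to \<open>T\<close>: the jump term is
  \<open>tail_integral_le_weighted_moment\<close>, and the diffusive term is supplied by the shell from \<open>T / M\<close>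
  to \<open>T\<close>. Each of the two is bounded by the whole integral, so half of their sum is, too.\<close>

lemma jump_integral_lower:
  fixes q H :: "real \<Rightarrow> real"
  assumes levy: "levy_measure \<nu>" and pos: "0 < T" "0 \<le> e" "0 \<le> v" "0 < a" "1 < M"
    and halving: "\<And>s. 0 < s \<Longrightarrow> s \<le> T \<Longrightarrow> 2 * tail \<nu> s \<le> tail \<nu> (s / M)"
    and anti: "\<And>s t. 0 < s \<Longrightarrow> s \<le> t \<Longrightarrow> H t \<le> H s"
    and bdd: "\<And>s. 0 < s \<Longrightarrow> 0 \<le> H s \<and> H s \<le> 1"
    and jumps: "\<And>s. 0 < s \<Longrightarrow> s \<le> T \<Longrightarrow> a * (e * (s * H s)) \<le> q s"
    and diffusive: "\<And>s. T / M < s \<Longrightarrow> s \<le> T \<Longrightarrow> a * v \<le> q s"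
  shows "ennreal (a / (2 * M)) *
      (ennreal e * (\<integral>\<^sup>+ s\<in>{0<..<T}. ennreal (H s * tail \<nu> s) \<partial>lborel) + ennreal (v * tail \<nu> T))
    \<le> (\<integral>\<^sup>+ s\<in>{0<..}. ennreal (q s) \<partial>\<nu>)"
proof -
  note [measurable_cong] = levy_sets[OF levy]
  define K where "K s = (if 0 < s then H s else 1)" for s
  have K [measurable]: "K \<in> borel_measurable borel"
    unfolding K_def using antimono_cutoff_measurable[of H] anti bdd by blast
  have w0: "0 \<le> tail \<nu> T" by (simp add: tail_def)
  define B where "B = (\<integral>\<^sup>+ s\<in>{0<..<T}. ennreal (H s * tail \<nu> s) \<partial>lborel)"
  define J where "J = (\<integral>\<^sup>+ s\<in>{0<..}. ennreal (q s) \<partial>\<nu>)"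
  have "ennreal (a / M) * (ennreal e * B) \<le> ennreal (a / M) * (ennreal e * (ennreal M * (\<integral>\<^sup>+ u\<in>{0<..T}. ennreal (u * H u) \<partial>\<nu>)))"
    unfolding B_def using halving
    by (intro mult_left_mono tail_integral_le_weighted_moment[OF levy anti bdd]) (use pos in auto)
  also have "\<dots> = ennreal (a * e) * (\<integral>\<^sup>+ u\<in>{0<..T}. ennreal (u * H u) \<partial>\<nu>)"
  proof -
    have "ennreal (a * e) = ennreal (a / M) * (ennreal e * ennreal M)"
      using pos by (simp add: ennreal_mult[symmetric])
    then show ?thesis by (simp add: mult.assoc)
  qed
  also have "(\<integral>\<^sup>+ u\<in>{0<..T}. ennreal (u * H u) \<partial>\<nu>) = (\<integral>\<^sup>+ u\<in>{0<..T}. ennreal (u * K u) \<partial>\<nu>)"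
    by (intro nn_integral_cong) (simp add: K_def indicator_def)
  also have "ennreal (a * e) * \<dots> = (\<integral>\<^sup>+ u. ennreal (a * e) * (ennreal (u * K u) * indicator {0<..T} u) \<partial>\<nu>)"
    by (rule nn_integral_cmult[symmetric]) measurable
  also have "\<dots> \<le> J" unfolding J_def
  proof (intro nn_integral_mono)
    fix u :: real
    show "ennreal (a * e) * (ennreal (u * K u) * indicator {0<..T} u) \<le> ennreal (q u) * indicator {0<..} u"
      using jumps[of u] pos bdd[of u]
      by (auto simp: indicator_def K_def ennreal_mult[symmetric] mult.assoc intro!: ennreal_leI)
  qed
  finally have 1: "ennreal (a / M) * (ennreal e * B) \<le> J" .
  have TM: "0 < T / M" "T / M \<le> T" using pos by (auto simp: field_simps)
  have "ennreal (a / M) * ennreal (v * tail \<nu> T) = ennreal (v * tail \<nu> T * (a / M))"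
    using pos w0 by (simp add: ennreal_mult[symmetric] mult.commute)
  also have "\<dots> \<le> ennreal (a * v * tail \<nu> T)"
  proof (rule ennreal_leI)
    have "v * tail \<nu> T * (a / M) \<le> v * tail \<nu> T * a"
      using pos w0 by (intro mult_left_mono) (auto simp: field_simps)
    then show "v * tail \<nu> T * (a / M) \<le> a * v * tail \<nu> T" by (simp add: mult_ac)
  qed
  also have "\<dots> \<le> ennreal (a * v * (tail \<nu> (T / M) - tail \<nu> T))"
    using halving[of T] pos by (intro ennreal_leI mult_left_mono) auto
  also have "\<dots> = (\<integral>\<^sup>+ u. ennreal (a * v) * indicator {T/M<..T} u \<partial>\<nu>)"
    using pos levy_interval[OF levy TM] tail_antimono[OF levy TM]
    by (subst nn_integral_cmult_indicator) (auto simp: levy_sets[OF levy] ennreal_mult)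
  also have "\<dots> \<le> J" unfolding J_def
    using diffusive TM by (intro nn_integral_mono) (auto simp: indicator_def intro!: ennreal_leI)
  finally have 2: "ennreal (a / M) * ennreal (v * tail \<nu> T) \<le> J" .
  have "ennreal (a / (2 * M)) * (ennreal e * B + ennreal (v * tail \<nu> T))
      = ennreal (1 / 2) * (ennreal (a / M) * (ennreal e * B) + ennreal (a / M) * ennreal (v * tail \<nu> T))"
  proof -
    have "ennreal (a / (2 * M)) = ennreal (1 / 2) * ennreal (a / M)"
      using pos by (subst ennreal_mult[symmetric]) auto
    then show ?thesis by (simp add: distrib_left mult.assoc)
  qed
  also have "\<dots> \<le> ennreal (1 / 2) * (J + J)" by (intro mult_left_mono add_mono 1 2) simp
  also have "\<dots> = (ennreal (1 / 2) + ennreal (1 / 2)) * J" by (simp only: distrib_left distrib_right)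
  also have "ennreal (1 / 2) + ennreal (1 / 2) = 1"
    by (subst ennreal_plus[symmetric]) auto
  finally show ?thesis unfolding B_def J_def by simp
qed

section \<open>Scale functions and their generalized inverse\<close>

lemma scale_pos:
  assumes "scale_functions \<Phi> \<Psi>" "0 < r"
  shows "0 < \<Phi> r"
proof -
  have "\<Phi> (r / 2) < \<Phi> r" "0 \<le> \<Phi> (r / 2)"
    using assms by (auto simp: scale_functions_def strict_mono_on_def)
  then show ?thesis by linarith
qed

lemma scale_less_iff:
  assumes "scale_functions \<Phi> \<Psi>" "0 \<le> r" "0 \<le> R"
  shows "\<Phi> r < \<Phi> R \<longleftrightarrow> r < R"
proof -
  have "strict_mono_on {0..} \<Phi>" using assms(1) by (simp add: scale_functions_def)
  from strict_mono_on_less[OF this] show ?thesis using assms(2,3) by simp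
qed

lemma scale_le_iff:
  assumes "scale_functions \<Phi> \<Psi>" "0 \<le> r" "0 \<le> R"
  shows "\<Phi> r \<le> \<Phi> R \<longleftrightarrow> r \<le> R"
  using scale_less_iff[OF assms(1,3,2)] by (simp add: not_less[symmetric])

lemma scale_growth_bounds:
  assumes "scale_functions \<Phi> \<Psi>"
  shows scale_growth: "\<exists>\<alpha>>0. \<exists>c>0. \<forall>r R. 0 < r \<longrightarrow> r \<le> R \<longrightarrow> \<Phi> R \<le> c * (R / r) powr \<alpha> * \<Phi> r"
    and scale_growth_lower: "\<exists>\<alpha>>0. \<exists>c>0. \<forall>r R. 0 < r \<longrightarrow> r \<le> R \<longrightarrow> c * (R / r) powr \<alpha> * \<Phi> r \<le> \<Phi> R"
proof -
  have "weak_scaling \<Phi>" using assms by (simp add: scale_functions_def)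
  then obtain \<alpha> \<alpha>' c c' where pos: "0 < \<alpha>" "0 < \<alpha>'" "0 < c" "0 < c'"
    and *: "\<forall>r R. 0 < r \<and> r \<le> R \<longrightarrow> c * (R / r) powr \<alpha> \<le> \<Phi> R / \<Phi> r \<and> \<Phi> R / \<Phi> r \<le> c' * (R / r) powr \<alpha>'"
    unfolding weak_scaling_def by (elim exE conjE)
  have "\<Phi> R \<le> c' * (R / r) powr \<alpha>' * \<Phi> r" if "0 < r" "r \<le> R" for r R
    using *[rule_format, of r R] that scale_pos[OF assms that(1)] by (simp add: pos_divide_le_eq)
  with pos show "\<exists>\<alpha>>0. \<exists>c>0. \<forall>r R. 0 < r \<longrightarrow> r \<le> R \<longrightarrow> \<Phi> R \<le> c * (R / r) powr \<alpha> * \<Phi> r"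
    by (intro exI[of _ \<alpha>'] exI[of _ c'] conjI allI impI) auto
  have "c * (R / r) powr \<alpha> * \<Phi> r \<le> \<Phi> R" if "0 < r" "r \<le> R" for r R
    using *[rule_format, of r R] that scale_pos[OF assms that(1)] by (simp add: pos_le_divide_eq)
  with pos show "\<exists>\<alpha>>0. \<exists>c>0. \<forall>r R. 0 < r \<longrightarrow> r \<le> R \<longrightarrow> c * (R / r) powr \<alpha> * \<Phi> r \<le> \<Phi> R"
    by (intro exI[of _ \<alpha>] exI[of _ c] conjI allI impI) auto
qed

text \<open>Qualitative form of the lower scaling exponent: enlarging the radius by a fixed factor enlarges
  \<open>\<Phi>\<close> by as much as desired. It yields the limits \<open>0\<close> and \<open>\<infinity>\<close> of \<open>\<Phi>\<close> at the ends, which make the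
  generalized inverse positive and finite.\<close>

lemma scale_unbounded_ratio:
  assumes "scale_functions \<Phi> \<Psi>" "0 < K"
  shows "\<exists>Z\<ge>1. \<forall>r>0. K * \<Phi> r \<le> \<Phi> (Z * r)"
proof -
  obtain \<alpha> c where ac: "0 < \<alpha>" "0 < c" and
    *: "\<forall>r R. 0 < r \<longrightarrow> r \<le> R \<longrightarrow> c * (R / r) powr \<alpha> * \<Phi> r \<le> \<Phi> R"
    using scale_growth_lower[OF assms(1)] by blast
  define Z where "Z = max 1 ((K / c) powr (1 / \<alpha>))"
  have Z: "1 \<le> Z" "(K / c) powr (1 / \<alpha>) \<le> Z" by (auto simp: Z_def)
  have "K / c = ((K / c) powr (1 / \<alpha>)) powr \<alpha>" using ac assms by (simp add: powr_powr)
  also have "\<dots> \<le> Z powr \<alpha>" using ac Z by (intro powr_mono2) auto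
  finally have K: "K \<le> c * Z powr \<alpha>" using ac by (simp add: field_simps)
  have "K * \<Phi> r \<le> \<Phi> (Z * r)" if "0 < r" for r
  proof -
    have "K * \<Phi> r \<le> c * Z powr \<alpha> * \<Phi> r"
      using K scale_pos[OF assms(1) that] by (intro mult_right_mono) auto
    also have "\<dots> \<le> \<Phi> (Z * r)" using *[rule_format, of r "Z * r"] that Z(1) by simp
    finally show ?thesis .
  qed
  then show ?thesis using Z(1) by (intro exI[of _ Z]) auto
qed

lemma scale_inv_set:
  assumes "scale_functions \<Phi> \<Psi>" "0 < t"
  shows "{s. 0 \<le> s \<and> t < \<Phi> s} \<noteq> {}" "bdd_below {s. 0 \<le> s \<and> t < \<Phi> s}"
proof -
  have p: "0 < \<Phi> 1" using scale_pos[OF assms(1)] by simp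
  then have "0 < 2 * t / \<Phi> 1" using assms(2) by simp
  then obtain Z where Z: "1 \<le> Z" "\<forall>r>0. 2 * t / \<Phi> 1 * \<Phi> r \<le> \<Phi> (Z * r)"
    using scale_unbounded_ratio[OF assms(1)] by blast
  have "2 * t \<le> \<Phi> Z" using Z(2)[rule_format, of 1] p by simp
  then have "Z \<in> {s. 0 \<le> s \<and> t < \<Phi> s}" using Z(1) assms(2) by simp
  then show "{s. 0 \<le> s \<and> t < \<Phi> s} \<noteq> {}" by blast
  show "bdd_below {s. 0 \<le> s \<and> t < \<Phi> s}" by (rule bdd_belowI[of _ 0]) auto
qed

text \<open>Since \<open>\<Phi>\<close> may jump, \<open>\<Phi> (scale_inv \<Phi> t) = t\<close> can fail. This and the next lemma say what
  remains on either side of the inverse.\<close>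

lemma scale_le_if_less_scale_inv:
  assumes "scale_functions \<Phi> \<Psi>" "0 < t" "0 \<le> s" "s < scale_inv \<Phi> t"
  shows "\<Phi> s \<le> t"
proof (rule ccontr)
  assume "\<not> \<Phi> s \<le> t"
  then have "scale_inv \<Phi> t \<le> s" unfolding scale_inv_def
    using assms(3) by (intro cInf_lower scale_inv_set(2)[OF assms(1,2)]) auto
  then show False using assms(4) by simp
qed

lemma less_scale_if_scale_inv_less:
  assumes "scale_functions \<Phi> \<Psi>" "0 < t" "scale_inv \<Phi> t < s"
  shows "t < \<Phi> s"
proof -
  have "\<exists>u\<in>{s. 0 \<le> s \<and> t < \<Phi> s}. u < s"
    using assms(3) unfolding scale_inv_def by (intro cInf_lessD scale_inv_set(1)[OF assms(1,2)])
  then obtain u where u: "0 \<le> u" "t < \<Phi> u" "u < s" by blast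
  then have "\<Phi> u < \<Phi> s" using scale_less_iff[OF assms(1)] by simp
  then show ?thesis using u by simp
qed

lemma scale_inv_le:
  assumes "scale_functions \<Phi> \<Psi>" "0 < t" "t \<le> \<Phi> r" "0 \<le> r"
  shows "scale_inv \<Phi> t \<le> r"
proof (rule ccontr)
  assume "\<not> scale_inv \<Phi> t \<le> r"
  then have "r < scale_inv \<Phi> t" by simp
  from dense[OF this] obtain s where s: "r < s" "s < scale_inv \<Phi> t" by blast
  then have "\<Phi> s \<le> t" using assms(4) by (intro scale_le_if_less_scale_inv[OF assms(1,2)]) auto
  moreover have "\<Phi> r < \<Phi> s" using s assms(4) scale_less_iff[OF assms(1)] by simp
  ultimately show False using assms(3) by simp
qed

lemma le_scale_inv:
  assumes "scale_functions \<Phi> \<Psi>" "0 < t" "\<Phi> r \<le> t"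
  shows "r \<le> scale_inv \<Phi> t"
  using less_scale_if_scale_inv_less[OF assms(1,2), of r] assms(3) by linarith

lemma scale_inv_pos:
  assumes "scale_functions \<Phi> \<Psi>" "0 < t"
  shows "0 < scale_inv \<Phi> t"
proof -
  have p: "0 < \<Phi> 1" using scale_pos[OF assms(1)] by simp
  then have "0 < \<Phi> 1 / t" using assms(2) by simp
  then obtain Z where Z: "1 \<le> Z" "\<forall>r>0. \<Phi> 1 / t * \<Phi> r \<le> \<Phi> (Z * r)"
    using scale_unbounded_ratio[OF assms(1)] by blast
  have "\<Phi> 1 / t * \<Phi> (1 / Z) \<le> \<Phi> 1" using Z(1) Z(2)[rule_format, of "1 / Z"] by simp
  then have "\<Phi> (1 / Z) \<le> t" using p assms by (simp add: field_simps)
  then have "1 / Z \<le> scale_inv \<Phi> t" by (rule le_scale_inv[OF assms])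
  moreover have "0 < 1 / Z" using Z by simp
  ultimately show ?thesis by linarith
qed

text \<open>Time ratios are controlled by ratios of radii. Evaluating \<open>\<Phi>\<close> at half of the inverse, which is
  strictly below it, avoids the possible jump there.\<close>

lemma scale_ratio_le:
  assumes "scale_functions \<Phi> \<Psi>"
  shows "\<exists>\<alpha>>0. \<exists>c>0. \<forall>r s. 0 < s \<longrightarrow> s \<le> \<Phi> r \<longrightarrow> 0 < r \<longrightarrow>
    \<Phi> r / s \<le> c * (r / scale_inv \<Phi> s) powr \<alpha>"
proof -
  obtain \<alpha> c where ac: "0 < \<alpha>" "0 < c" and
    *: "\<forall>r R. 0 < r \<longrightarrow> r \<le> R \<longrightarrow> \<Phi> R \<le> c * (R / r) powr \<alpha> * \<Phi> r"
    using scale_growth[OF assms] by blast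
  have "\<Phi> r / s \<le> c * 2 powr \<alpha> * (r / scale_inv \<Phi> s) powr \<alpha>" if "0 < s" "s \<le> \<Phi> r" "0 < r" for r s
  proof -
    define q where "q = scale_inv \<Phi> s"
    have q: "0 < q" "q \<le> r" using that scale_inv_pos[OF assms, of s] scale_inv_le[OF assms, of s r] by (auto simp: q_def)
    have "\<Phi> r \<le> c * (r / (q / 2)) powr \<alpha> * \<Phi> (q / 2)" using q that by (intro *[rule_format]) auto
    also have "\<dots> \<le> c * (r / (q / 2)) powr \<alpha> * s"
      using q ac that by (intro mult_left_mono scale_le_if_less_scale_inv[OF assms]) (auto simp: q_def)
    also have "\<dots> = c * 2 powr \<alpha> * (r / q) powr \<alpha> * s"
      using q that by (simp add: powr_divide powr_mult)
    finally show ?thesis using that by (simp add: q_def field_simps)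
  qed
  then show ?thesis using ac by (intro exI[of _ \<alpha>] conjI exI[of _ "c * 2 powr \<alpha>"]) auto
qed

text \<open>From a fixed fraction of the time \<open>\<Phi> r\<close> on, the diffusive radius is at least a fixed fraction of
  \<open>r\<close>, so that the Gaussian factor is bounded below.\<close>

lemma scale_inv_comparable:
  assumes "scale_functions \<Phi> \<Psi>" "0 < M"
  shows "\<exists>Z\<ge>1. \<forall>r s. 0 < r \<longrightarrow> \<Phi> r / M < s \<longrightarrow> r \<le> Z * scale_inv \<Phi> s"
proof -
  obtain Z where Z: "1 \<le> Z" "\<forall>r>0. M * \<Phi> r \<le> \<Phi> (Z * r)"
    using scale_unbounded_ratio[OF assms] by blast
  have "r \<le> Z * scale_inv \<Phi> s" if "0 < r" "\<Phi> r / M < s" for r s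
  proof -
    have s: "0 < s" using that assms(2) scale_pos[OF assms(1), of r] by (smt (verit) divide_pos_pos)
    have "M * \<Phi> (r / Z) \<le> \<Phi> r" using Z(2)[rule_format, of "r / Z"] Z(1) that by simp
    also have "\<Phi> r < M * s" using that assms(2) by (simp add: field_simps)
    finally have "\<Phi> (r / Z) \<le> s" using assms(2) by simp
    then have "r / Z \<le> scale_inv \<Phi> s" by (rule le_scale_inv[OF assms(1) s])
    then show ?thesis using Z(1) by (simp add: field_simps)
  qed
  then show ?thesis using Z(1) by (intro exI[of _ Z]) auto
qed

section \<open>Volumes of balls\<close>

text \<open>Balls have finite measure because they lie in compact closed balls.\<close>

lemma vol_pos_mono:
  fixes m :: "'a::heine_borel measure"
  assumes "radon_measure m" "full_support m"
  shows vol_pos: "0 < r \<Longrightarrow> 0 < vol m x r"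
    and vol_mono: "r \<le> R \<Longrightarrow> vol m x r \<le> vol m x R"
    and vol_ball_subset: "ball x r \<subseteq> ball y R \<Longrightarrow> vol m x r \<le> vol m y R"
proof -
  have sets: "sets m = sets borel" and cpt: "\<And>K. compact K \<Longrightarrow> emeasure m K < \<infinity>"
    using assms(1) unfolding radon_measure_def by blast+
  have fin: "emeasure m (ball x r) < \<infinity>" for x r
  proof -
    have "emeasure m (ball x r) \<le> emeasure m (cball x r)"
      by (intro emeasure_mono) (auto simp: sets)
    also have "\<dots> < \<infinity>" by (intro cpt compact_cball)
    finally show ?thesis .
  qed
  show sub: "ball x r \<subseteq> ball y R \<Longrightarrow> vol m x r \<le> vol m y R" for x y r R
    unfolding vol_def measure_def using fin[of y R]
    by (intro enn2real_mono emeasure_mono) (auto simp: sets)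
  show "r \<le> R \<Longrightarrow> vol m x r \<le> vol m x R" by (rule sub) auto
  show "0 < vol m x r" if "0 < r"
  proof -
    have "0 < emeasure m (ball x r)" using assms(2) that by (simp add: full_support_def)
    then show ?thesis using fin[of x r] by (simp add: vol_def measure_def enn2real_positive_iff)
  qed
qed

text \<open>The constant in the doubling condition depends on the factor \<open>a\<close> that fixes the range of radii.
  For a bound \<open>L\<close> on the radii, one \<open>a\<close> suffices, and \<open>a = 1\<close> covers all radii if \<open>R\<^sub>E = \<infinity>\<close>.\<close>

lemma vol_doubling_upper:
  fixes m :: "'a::heine_borel measure"
  assumes "radon_measure m" "full_support m" "0 < R\<^sub>E" "volume_doubling m R\<^sub>E"
  shows "\<exists>C>0. \<exists>d>0. \<forall>x r R. 0 < r \<longrightarrow> r \<le> R \<longrightarrow> R \<le> L \<or> R\<^sub>E = \<infinity> \<longrightarrow>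
    vol m x R \<le> C * (R / r) powr d * vol m x r"
proof -
  obtain d1 d where d: "0 < d1" "d1 \<le> d" and
    all: "\<forall>a\<ge>1. \<exists>C\<ge>1. \<forall>x r R. 0 < r \<and> r \<le> R \<and> ereal R < ereal a * R\<^sub>E \<longrightarrow>
      inverse C * (R / r) powr d1 \<le> vol m x R / vol m x r \<and> vol m x R / vol m x r \<le> C * (R / r) powr d"
    using assms(4) unfolding volume_doubling_def by (elim exE conjE)
  obtain a where a: "1 \<le> a" "\<And>R. R \<le> L \<or> R\<^sub>E = \<infinity> \<Longrightarrow> ereal R < ereal a * R\<^sub>E"
  proof (cases R\<^sub>E)
    case (real e)
    then have e: "0 < e" using assms(3) by simp
    define a\<^sub>0 where "a\<^sub>0 = max 1 (L / e + 1)"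
    have "L < (L / e + 1) * e" using e by (simp add: field_simps)
    also have "\<dots> \<le> a\<^sub>0 * e" using e unfolding a\<^sub>0_def by (intro mult_right_mono) auto
    finally have "L < a\<^sub>0 * e" .
    show ?thesis
    proof (rule that)
      show "1 \<le> a\<^sub>0" by (simp add: a\<^sub>0_def)
      show "ereal R < ereal a\<^sub>0 * R\<^sub>E" if "R \<le> L \<or> R\<^sub>E = \<infinity>" for R
        using that real \<open>L < a\<^sub>0 * e\<close> by auto
    qed
  next
    case PInf then show ?thesis using that[of 1] by auto
  qed (use assms(3) in auto)
  obtain C where C: "C \<ge> 1" "\<forall>x r R. 0 < r \<and> r \<le> R \<and> ereal R < ereal a * R\<^sub>E \<longrightarrow>
      inverse C * (R / r) powr d1 \<le> vol m x R / vol m x r \<and> vol m x R / vol m x r \<le> C * (R / r) powr d"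
    using all[THEN spec, THEN mp, OF a(1)] by (elim exE conjE)
  have "vol m x R \<le> C * (R / r) powr d * vol m x r" if "0 < r" "r \<le> R" "R \<le> L \<or> R\<^sub>E = \<infinity>" for x r R
  proof -
    have "vol m x R / vol m x r \<le> C * (R / r) powr d" using C(2) a(2)[OF that(3)] that by blast
    then show ?thesis using vol_pos[OF assms(1,2) that(1)] by (simp add: pos_divide_le_eq)
  qed
  moreover have "0 < C" "0 < d" using C d by auto
  ultimately show ?thesis by (intro exI[of _ C] conjI exI[of _ d]) auto
qed

section \<open>The shape of the heat kernel at a fixed pair of points\<close>

text \<open>From \<open>ln t \<le> t - 1\<close> at \<open>t = z * c / N\<close>, for which \<open>N * t = c * z \<le> c * z\<^sup>2\<close>.\<close>

lemma gaussian_beats_power: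
  fixes c N z :: real
  assumes "0 < c" "0 < N" "1 \<le> z"
  shows "z powr N * exp (- c * z\<^sup>2) \<le> exp (N * ln (N / c))"
proof -
  have "ln (z * c / N) \<le> z * c / N - 1" using assms by (intro ln_le_minus_one) auto
  then have "N * ln (z * c / N) \<le> N * (z * c / N)" using assms by (intro mult_left_mono) auto
  then have "N * ln z \<le> c * z + N * ln (N / c)"
    using assms by (simp add: ln_mult ln_div algebra_simps)
  moreover have "c * z \<le> c * z\<^sup>2" using assms by (simp add: power2_eq_square)
  ultimately have "N * ln z - c * z\<^sup>2 \<le> N * ln (N / c)" by linarith
  then have "exp (N * ln z - c * z\<^sup>2) \<le> exp (N * ln (N / c))" by simp
  then show ?thesis using assms by (simp add: powr_def exp_diff exp_minus divide_inverse)
qed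

text \<open>The two coefficients that the points \<open>x\<close> and \<open>y\<close> contribute to the jump kernel: that of \<open>B_star\<close>
  and that of the tail.\<close>

definition jump_coeff :: "'a::metric_space measure \<Rightarrow> (real \<Rightarrow> real) \<Rightarrow> real \<Rightarrow> 'a \<Rightarrow> 'a \<Rightarrow> real" where
  "jump_coeff m \<Psi> C\<^sub>0 x y = C\<^sub>0 / (vol m x (dist x y) * \<Psi> (dist x y))"

definition diffusive_coeff ::
  "'a::metric_space measure \<Rightarrow> (real \<Rightarrow> real) \<Rightarrow> (real \<Rightarrow> 'a \<Rightarrow> 'a \<Rightarrow> real) \<Rightarrow> 'a \<Rightarrow> 'a \<Rightarrow> real" where
  "diffusive_coeff m \<Phi> h x y = h (\<Phi> (dist x y)) x y / vol m x (dist x y)"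

text \<open>The part of the heat kernel estimates that matters for the jump kernel: before the time
  \<open>\<Phi> (dist x y)\<close>, a jump term linear in \<open>s\<close> plus a remainder of arbitrarily high polynomial decay
  as \<open>s\<close> tends to \<open>0\<close>, and a constant afterwards. The range \<open>I\<close> of times is a parameter since small and
  large times are treated separately if the domain is bounded.\<close>

definition upper_profile ::
  "'a::metric_space set \<Rightarrow> 'a measure \<Rightarrow> (real \<Rightarrow> real) \<Rightarrow> (real \<Rightarrow> real) \<Rightarrow>
    (real \<Rightarrow> 'a \<Rightarrow> 'a \<Rightarrow> real) \<Rightarrow> (real \<Rightarrow> 'a \<Rightarrow> 'a \<Rightarrow> real) \<Rightarrow> real \<Rightarrow> real set \<Rightarrow> bool" where
  "upper_profile D m \<Phi> \<Psi> h p C\<^sub>0 I \<longleftrightarrow>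
     (\<forall>k>0. \<exists>A>0. \<forall>x\<in>D. \<forall>y\<in>D. x \<noteq> y \<longrightarrow> (\<forall>s\<in>I.
        (s < \<Phi> (dist x y) \<longrightarrow> p s x y \<le>
           A * (jump_coeff m \<Psi> C\<^sub>0 x y * (s * h s x y)
                + diffusive_coeff m \<Phi> h x y * (s / \<Phi> (dist x y)) powr k)) \<and>
        (\<Phi> (dist x y) \<le> s \<longrightarrow> p s x y \<le> A * diffusive_coeff m \<Phi> h x y)))"

text \<open>The diffusive lower bound is restricted to times comparable to \<open>\<Phi> (dist x y)\<close>, since the Gaussian
  factor has no positive lower bound as \<open>s\<close> tends to \<open>0\<close>.\<close>

definition lower_profile ::
  "'a::metric_space set \<Rightarrow> 'a measure \<Rightarrow> (real \<Rightarrow> real) \<Rightarrow> (real \<Rightarrow> real) \<Rightarrow>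
    (real \<Rightarrow> 'a \<Rightarrow> 'a \<Rightarrow> real) \<Rightarrow> (real \<Rightarrow> 'a \<Rightarrow> 'a \<Rightarrow> real) \<Rightarrow> real \<Rightarrow> real set \<Rightarrow> bool" where
  "lower_profile D m \<Phi> \<Psi> h p C\<^sub>0 I \<longleftrightarrow>
     (\<forall>M>1. \<exists>a>0. \<forall>x\<in>D. \<forall>y\<in>D. x \<noteq> y \<longrightarrow> (\<forall>s\<in>I. s \<le> \<Phi> (dist x y) \<longrightarrow>
        a * (jump_coeff m \<Psi> C\<^sub>0 x y * (s * h s x y)) \<le> p s x y \<and>
        (\<Phi> (dist x y) / M < s \<longrightarrow> a * diffusive_coeff m \<Phi> h x y \<le> p s x y)))"

lemma boundary_nonneg: "boundary_function D \<Phi> h \<Longrightarrow> 0 < s \<Longrightarrow> x \<in> D \<Longrightarrow> y \<in> D \<Longrightarrow> 0 \<le> h s x y"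
  and boundary_le_1: "boundary_function D \<Phi> h \<Longrightarrow> 0 < s \<Longrightarrow> x \<in> D \<Longrightarrow> y \<in> D \<Longrightarrow> h s x y \<le> 1"
  and boundary_antimono: "boundary_function D \<Phi> h \<Longrightarrow> 0 < s \<Longrightarrow> s \<le> t \<Longrightarrow> x \<in> D \<Longrightarrow> y \<in> D \<Longrightarrow> h t x y \<le> h s x y"
  unfolding boundary_function_def by simp_all

lemma scale_dist_le_diameter:
  assumes "scale_functions \<Phi> \<Psi>" "x \<in> D" "y \<in> D" "bounded D"
  shows "\<Phi> (dist x y) \<le> \<Phi> (diameter D)"
proof -
  have "dist x y \<le> diameter D" using assms by (intro diameter_bounded_bound)
  then show ?thesis using scale_le_iff[OF assms(1), of "dist x y" "diameter D"] zero_le_dist[of x y]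
    by (simp del: zero_le_dist)
qed

text \<open>Up to the time \<open>\<Phi> (dist x y)\<close> the range of times in the second condition on a boundary function
  is never left, because the distance is at most the diameter of \<open>D\<close>.\<close>

lemma boundary_doubling:
  assumes "scale_functions \<Phi> \<Psi>" "boundary_function D \<Phi> h"
  shows "\<exists>c>0. \<exists>\<gamma>\<ge>0. \<forall>x\<in>D. \<forall>y\<in>D. \<forall>s>0. s \<le> \<Phi> (dist x y) \<longrightarrow>
    h s x y \<le> c * (\<Phi> (dist x y) / s) powr \<gamma> * h (\<Phi> (dist x y)) x y"
proof -
  obtain c \<gamma> where c: "0 < c" "0 \<le> \<gamma>" and
    *: "\<forall>s t. 0 < s \<and> s \<le> t \<and> ereal t < 4 * scale_diam \<Phi> D + 1 \<longrightarrow>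
        (\<forall>x\<in>D. \<forall>y\<in>D. s powr \<gamma> * h s x y \<le> c * t powr \<gamma> * h t x y)"
    using assms(2) unfolding boundary_function_def by (elim exE conjE)
  have "h s x y \<le> c * (\<Phi> (dist x y) / s) powr \<gamma> * h (\<Phi> (dist x y)) x y"
    if xy: "x \<in> D" "y \<in> D" and s: "0 < s" "s \<le> \<Phi> (dist x y)" for x y s
  proof -
    have "ereal (\<Phi> (dist x y)) < 4 * scale_diam \<Phi> D + 1"
    proof (cases "bounded D")
      case True
      have "\<Phi> (dist x y) < 4 * \<Phi> (diameter D) + 1"
        using scale_dist_le_diameter[OF assms(1) xy True] s by linarith
      then have "ereal (\<Phi> (dist x y)) < ereal 4 * ereal (\<Phi> (diameter D)) + ereal 1" by simp
      then show ?thesis using True by (simp add: scale_diam_def one_ereal_def)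
    qed (simp add: scale_diam_def)
    then have "s powr \<gamma> * h s x y \<le> c * \<Phi> (dist x y) powr \<gamma> * h (\<Phi> (dist x y)) x y"
      using * s xy by blast
    then show ?thesis using s by (simp add: powr_divide field_simps)
  qed
  with c show ?thesis by (intro exI[of _ c] exI[of _ \<gamma>] conjI ballI allI impI) auto
qed

text \<open>The last inequality uses \<open>\<Phi> \<le> \<Psi>\<close>: up to the time \<open>\<Phi> (dist x y)\<close> the jump term is dominated
  by the on-diagonal value, so that it is not cut off by the minimum in the heat kernel bound.\<close>

lemma coeff_nonneg:
  fixes m :: "'a::heine_borel measure"
  assumes "radon_measure m" "full_support m" "scale_functions \<Phi> \<Psi>" "boundary_function D \<Phi> h"
    and "0 \<le> C\<^sub>0" "C\<^sub>0 \<le> 1" "x \<in> D" "y \<in> D" "x \<noteq> y"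
  shows jump_coeff_nonneg: "0 \<le> jump_coeff m \<Psi> C\<^sub>0 x y"
    and diffusive_coeff_nonneg: "0 \<le> diffusive_coeff m \<Phi> h x y"
    and jump_coeff_bound: "0 < s \<Longrightarrow> s \<le> \<Phi> (dist x y) \<Longrightarrow> jump_coeff m \<Psi> C\<^sub>0 x y * s \<le> 1 / vol m x (dist x y)"
proof -
  have r: "0 < dist x y" using assms by simp
  have V: "0 < vol m x (dist x y)" by (rule vol_pos[OF assms(1,2) r])
  have \<Phi>: "0 < \<Phi> (dist x y)" by (rule scale_pos[OF assms(3) r])
  have \<Psi>: "\<Phi> (dist x y) \<le> \<Psi> (dist x y)" using assms(3) by (simp add: scale_functions_def)
  show "0 \<le> jump_coeff m \<Psi> C\<^sub>0 x y" using V \<Phi> \<Psi> assms(5) by (simp add: jump_coeff_def)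
  show "0 \<le> diffusive_coeff m \<Phi> h x y"
    using V boundary_nonneg[OF assms(4) \<Phi>] assms(7,8) by (simp add: diffusive_coeff_def)
  show "jump_coeff m \<Psi> C\<^sub>0 x y * s \<le> 1 / vol m x (dist x y)" if "0 < s" "s \<le> \<Phi> (dist x y)"
  proof -
    have "C\<^sub>0 * s \<le> 1 * \<Psi> (dist x y)" using that \<Psi> assms(5,6) by (intro mult_mono) auto
    then have "C\<^sub>0 * s / \<Psi> (dist x y) \<le> 1" using \<Phi> \<Psi> by simp
    then have "C\<^sub>0 * s / \<Psi> (dist x y) / vol m x (dist x y) \<le> 1 / vol m x (dist x y)"
      using V by (intro divide_right_mono) auto
    then show ?thesis by (simp add: jump_coeff_def mult.commute)
  qed
qed

text \<open>Let \<open>z\<close> be the quotient of \<open>dist x y\<close> by the diffusive radius at time \<open>s\<close>. Before the time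
  \<open>\<Phi> (dist x y)\<close>, replacing the boundary function and the volume at \<open>s\<close> by those at scale \<open>dist x y\<close>,
  as well as extracting a power of \<open>s\<close>, costs powers of \<open>z\<close>. All of them are absorbed by the
  Gaussian factor in \<open>z\<close>. Afterwards, monotonicity of the volume and of the boundary function suffices.\<close>

lemma upper_profile_heat_kernel:
  fixes m :: "'a::heine_borel measure"
  assumes m: "radon_measure m" "full_support m" and sf: "scale_functions \<Phi> \<Psi>"
    and bf: "boundary_function D \<Phi> h" and C\<^sub>0: "0 \<le> C\<^sub>0" "C\<^sub>0 \<le> 1"
    and doubling: "0 < C" "0 < d" "\<And>x y r. x \<in> D \<Longrightarrow> y \<in> D \<Longrightarrow> 0 < r \<Longrightarrow> r \<le> dist x y \<Longrightarrow>
      vol m x (dist x y) \<le> C * (dist x y / r) powr d * vol m x r"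
    and I: "I \<subseteq> {0<..}" and hk: "HK_estimate D m \<Phi> \<Psi> h p C\<^sub>0 I"
  shows "upper_profile D m \<Phi> \<Psi> h p C\<^sub>0 I"
  unfolding upper_profile_def
proof (intro allI impI)
  fix k :: real assume k: "0 < k"
  obtain b c where pos: "0 < b" "0 < c" and
    hk: "\<forall>t\<in>I. \<forall>x\<in>D. \<forall>y\<in>D. p t x y \<le> b * h t x y * HK_form m \<Phi> \<Psi> C\<^sub>0 c t x y"
    using hk unfolding HK_estimate_def by blast
  obtain c1 \<gamma> where h2: "0 < c1" "0 \<le> \<gamma>" "\<forall>x\<in>D. \<forall>y\<in>D. \<forall>s>0. s \<le> \<Phi> (dist x y) \<longrightarrow>
    h s x y \<le> c1 * (\<Phi> (dist x y) / s) powr \<gamma> * h (\<Phi> (dist x y)) x y"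
    using boundary_doubling[OF sf bf] by (elim exE conjE)
  obtain \<alpha> c2 where sr: "0 < \<alpha>" "0 < c2" "\<forall>r s. 0 < s \<longrightarrow> s \<le> \<Phi> r \<longrightarrow> 0 < r \<longrightarrow>
    \<Phi> r / s \<le> c2 * (r / scale_inv \<Phi> s) powr \<alpha>"
    using scale_ratio_le[OF sf] by (elim exE conjE)
  \<comment> \<open>The total power of \<open>z\<close>: \<open>\<gamma>\<close> from the boundary function and \<open>k\<close> from the power of \<open>s\<close>, both
    converted from times to radii by \<open>\<alpha>\<close>, and \<open>d\<close> from the volume.\<close>
  define N where "N = \<alpha> * (\<gamma> + k) + d"
  have N: "0 < N" using sr h2 k doubling by (simp add: N_def add_nonneg_pos)
  define A where "A = c1 * C * c2 powr (\<gamma> + k) * exp (N * ln (N / c))"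
  have A: "0 < A" using h2 doubling sr by (simp add: A_def)
  have "(s < \<Phi> (dist x y) \<longrightarrow> p s x y \<le>
           b * (1 + A) * (jump_coeff m \<Psi> C\<^sub>0 x y * (s * h s x y)
                + diffusive_coeff m \<Phi> h x y * (s / \<Phi> (dist x y)) powr k)) \<and>
        (\<Phi> (dist x y) \<le> s \<longrightarrow> p s x y \<le> b * (1 + A) * diffusive_coeff m \<Phi> h x y)"
    if xy: "x \<in> D" "y \<in> D" "x \<noteq> y" and "s \<in> I" for x y s
  proof -
    define r T q V where "r = dist x y" and "T = \<Phi> r" and "q = scale_inv \<Phi> s" and "V = vol m x r"
    have s: "0 < s" using I \<open>s \<in> I\<close> by auto
    have r: "0 < r" using xy by (simp add: r_def)
    have T: "0 < T" unfolding T_def by (rule scale_pos[OF sf r])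
    have q: "0 < q" unfolding q_def by (rule scale_inv_pos[OF sf s])
    have V: "0 < V" "0 < vol m x q" using vol_pos[OF m] r q by (auto simp: V_def)
    have hs: "0 \<le> h s x y" "0 \<le> h T x y" using boundary_nonneg[OF bf] s T xy by auto
    note nn = coeff_nonneg[OF m sf bf C\<^sub>0 xy]
    have ps: "p s x y \<le> b * h s x y * HK_form m \<Phi> \<Psi> C\<^sub>0 c s x y" using hk \<open>s \<in> I\<close> xy by blast
    have near: "p s x y \<le> b * (1 + A) * (jump_coeff m \<Psi> C\<^sub>0 x y * (s * h s x y)
                + diffusive_coeff m \<Phi> h x y * (s / T) powr k)" if sT: "s < T"
    proof -
      define z where "z = r / q"
      have "q \<le> r" unfolding q_def using scale_inv_le[OF sf s] sT r by (simp add: T_def)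
      then have z: "1 \<le> z" "r / q = z" using q by (simp_all add: z_def)
      have "V \<le> C * z powr d * vol m x q"
        using doubling(3)[OF xy(1,2) q] \<open>q \<le> r\<close> by (simp add: V_def r_def z_def)
      then have v: "1 / vol m x q \<le> C * z powr d / V" using V by (simp add: field_simps)
      have "T / s \<le> c2 * z powr \<alpha>" using sr(3) s sT r by (auto simp: T_def q_def z_def)
      then have "(T / s) powr (\<gamma> + k) \<le> (c2 * z powr \<alpha>) powr (\<gamma> + k)"
        using T s h2 k by (intro powr_mono2) auto
      also have "\<dots> = c2 powr (\<gamma> + k) * z powr (\<alpha> * (\<gamma> + k))"
        using sr by (simp add: powr_mult powr_powr)
      finally have ts: "(T / s) powr (\<gamma> + k) \<le> c2 powr (\<gamma> + k) * z powr (\<alpha> * (\<gamma> + k))" .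
      have "h s x y \<le> c1 * (T / s) powr \<gamma> * h T x y"
        using h2(3) xy s sT by (auto simp: T_def r_def)
      also have "\<dots> = c1 * ((T / s) powr (\<gamma> + k) * (s / T) powr k) * h T x y"
        using T s by (simp add: powr_add powr_divide)
      also have "\<dots> \<le> c1 * ((c2 powr (\<gamma> + k) * z powr (\<alpha> * (\<gamma> + k))) * (s / T) powr k) * h T x y"
        using h2 hs by (intro mult_right_mono mult_left_mono ts) auto
      finally have hsz: "h s x y \<le> c1 * ((c2 powr (\<gamma> + k) * z powr (\<alpha> * (\<gamma> + k))) * (s / T) powr k) * h T x y" .
      have "h s x y * (1 / vol m x q) \<le>
          (c1 * ((c2 powr (\<gamma> + k) * z powr (\<alpha> * (\<gamma> + k))) * (s / T) powr k) * h T x y) * (C * z powr d / V)"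
        using hs V h2 by (intro mult_mono hsz v) auto
      then have "h s x y * (1 / vol m x q) * exp (- c * z\<^sup>2) \<le>
          (c1 * ((c2 powr (\<gamma> + k) * z powr (\<alpha> * (\<gamma> + k))) * (s / T) powr k) * h T x y) * (C * z powr d / V) * exp (- c * z\<^sup>2)"
        by (rule mult_right_mono) simp
      also have "\<dots> = (c1 * C * c2 powr (\<gamma> + k)) * (h T x y / V * (s / T) powr k) * (z powr N * exp (- c * z\<^sup>2))"
        by (simp add: N_def powr_add)
      also have "\<dots> \<le> (c1 * C * c2 powr (\<gamma> + k)) * (h T x y / V * (s / T) powr k) * exp (N * ln (N / c))"
        using h2 doubling V hs by (intro mult_left_mono gaussian_beats_power pos N z) auto
      also have "\<dots> = A * (diffusive_coeff m \<Phi> h x y * (s / T) powr k)"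
        by (simp add: A_def diffusive_coeff_def T_def r_def V_def)
      finally have gauss: "h s x y * (1 / vol m x q) * exp (- c * z\<^sup>2) \<le> A * (diffusive_coeff m \<Phi> h x y * (s / T) powr k)" .
      have "HK_form m \<Phi> \<Psi> C\<^sub>0 c s x y \<le> jump_coeff m \<Psi> C\<^sub>0 x y * s + 1 / vol m x q * exp (- c * z\<^sup>2)"
        unfolding HK_form_def jump_coeff_def by (intro min.coboundedI2) (simp add: q_def r_def z_def power_divide)
      then have "h s x y * HK_form m \<Phi> \<Psi> C\<^sub>0 c s x y \<le> h s x y * (jump_coeff m \<Psi> C\<^sub>0 x y * s + 1 / vol m x q * exp (- c * z\<^sup>2))"
        using hs by (intro mult_left_mono) auto
      also have "\<dots> \<le> jump_coeff m \<Psi> C\<^sub>0 x y * (s * h s x y) + A * (diffusive_coeff m \<Phi> h x y * (s / T) powr k)"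
        using gauss by (simp add: algebra_simps)
      also have "\<dots> \<le> (1 + A) * (jump_coeff m \<Psi> C\<^sub>0 x y * (s * h s x y)) + (1 + A) * (diffusive_coeff m \<Phi> h x y * (s / T) powr k)"
      proof (intro add_mono)
        have "0 \<le> A * (jump_coeff m \<Psi> C\<^sub>0 x y * (s * h s x y))" using A nn(1) s hs by simp
        then show "jump_coeff m \<Psi> C\<^sub>0 x y * (s * h s x y) \<le> (1 + A) * (jump_coeff m \<Psi> C\<^sub>0 x y * (s * h s x y))"
          by (simp add: distrib_right)
        have "0 \<le> diffusive_coeff m \<Phi> h x y * (s / T) powr k" using nn(2) by simp
        then show "A * (diffusive_coeff m \<Phi> h x y * (s / T) powr k) \<le> (1 + A) * (diffusive_coeff m \<Phi> h x y * (s / T) powr k)"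
          by (simp add: distrib_right)
      qed
      finally have "b * (h s x y * HK_form m \<Phi> \<Psi> C\<^sub>0 c s x y) \<le> b * ((1 + A) * (jump_coeff m \<Psi> C\<^sub>0 x y * (s * h s x y)
          + diffusive_coeff m \<Phi> h x y * (s / T) powr k))"
        using pos by (intro mult_left_mono) (auto simp: distrib_left)
      then show ?thesis using ps by (simp only: mult.assoc)
    qed
    have far: "p s x y \<le> b * (1 + A) * diffusive_coeff m \<Phi> h x y" if sT: "T \<le> s"
    proof -
      have "r \<le> q" unfolding q_def using le_scale_inv[OF sf s] sT by (simp add: T_def)
      then have "1 / vol m x q \<le> 1 / V" unfolding V_def using vol_mono[OF m] V by (intro divide_left_mono) (auto simp: V_def)
      then have "HK_form m \<Phi> \<Psi> C\<^sub>0 c s x y \<le> 1 / V" unfolding HK_form_def by (intro min.coboundedI1) (simp add: q_def)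
      then have "h s x y * HK_form m \<Phi> \<Psi> C\<^sub>0 c s x y \<le> h s x y * (1 / V)" using hs by (intro mult_left_mono)
      also have "\<dots> \<le> h T x y * (1 / V)" using boundary_antimono[OF bf T sT xy(1,2)] V by (intro mult_right_mono) auto
      also have "\<dots> = diffusive_coeff m \<Phi> h x y" by (simp add: diffusive_coeff_def T_def r_def V_def)
      also have "\<dots> \<le> (1 + A) * diffusive_coeff m \<Phi> h x y" using nn(2) A by (simp add: distrib_right)
      finally have "b * (h s x y * HK_form m \<Phi> \<Psi> C\<^sub>0 c s x y) \<le> b * ((1 + A) * diffusive_coeff m \<Phi> h x y)"
        using pos by (intro mult_left_mono) auto
      then show ?thesis using ps by (simp only: mult.assoc)
    qed
    show ?thesis using near far by (simp add: T_def r_def)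
  qed
  moreover have "0 < b * (1 + A)" using pos A by simp
  ultimately show "\<exists>A>0. \<forall>x\<in>D. \<forall>y\<in>D. x \<noteq> y \<longrightarrow> (\<forall>s\<in>I.
        (s < \<Phi> (dist x y) \<longrightarrow> p s x y \<le>
           A * (jump_coeff m \<Psi> C\<^sub>0 x y * (s * h s x y)
                + diffusive_coeff m \<Phi> h x y * (s / \<Phi> (dist x y)) powr k)) \<and>
        (\<Phi> (dist x y) \<le> s \<longrightarrow> p s x y \<le> A * diffusive_coeff m \<Phi> h x y))"
    by (intro exI[of _ "b * (1 + A)"] conjI ballI impI) simp_all
qed

text \<open>Before the time \<open>\<Phi> (dist x y)\<close> the diffusive radius is at most \<open>dist x y\<close>, so that the
  on-diagonal term dominates both lower bounds; the Gaussian factor is at least \<open>exp (- c * Z\<^sup>2)\<close>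
  at times comparable to \<open>\<Phi> (dist x y)\<close>.\<close>

lemma lower_profile_heat_kernel:
  fixes m :: "'a::heine_borel measure"
  assumes m: "radon_measure m" "full_support m" and sf: "scale_functions \<Phi> \<Psi>"
    and bf: "boundary_function D \<Phi> h" and C\<^sub>0: "0 \<le> C\<^sub>0" "C\<^sub>0 \<le> 1"
    and I: "I \<subseteq> {0<..}" and hk: "HK_estimate D m \<Phi> \<Psi> h p C\<^sub>0 I"
  shows "lower_profile D m \<Phi> \<Psi> h p C\<^sub>0 I"
  unfolding lower_profile_def
proof (intro allI impI)
  fix M :: real assume M: "1 < M"
  obtain b c where pos: "0 < b" "0 < c" and
    hk: "\<forall>t\<in>I. \<forall>x\<in>D. \<forall>y\<in>D. b * h t x y * HK_form m \<Phi> \<Psi> C\<^sub>0 c t x y \<le> p t x y"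
    using hk unfolding HK_estimate_def by blast
  obtain Z where Z: "1 \<le> Z" "\<forall>r s. 0 < r \<longrightarrow> \<Phi> r / M < s \<longrightarrow> r \<le> Z * scale_inv \<Phi> s"
    using scale_inv_comparable[OF sf, of M] M by auto
  define a where "a = b * exp (- c * Z\<^sup>2)"
  have a: "0 < a" "a \<le> b" using pos by (auto simp: a_def)
  have "a * (jump_coeff m \<Psi> C\<^sub>0 x y * (s * h s x y)) \<le> p s x y \<and>
        (\<Phi> (dist x y) / M < s \<longrightarrow> a * diffusive_coeff m \<Phi> h x y \<le> p s x y)"
    if xy: "x \<in> D" "y \<in> D" "x \<noteq> y" and "s \<in> I" and sT': "s \<le> \<Phi> (dist x y)" for x y s
  proof -
    define r T q V where "r = dist x y" and "T = \<Phi> r" and "q = scale_inv \<Phi> s" and "V = vol m x r"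
    have s: "0 < s" using I \<open>s \<in> I\<close> by auto
    have sT: "s \<le> T" using sT' by (simp add: T_def r_def)
    have r: "0 < r" using xy by (simp add: r_def)
    have q: "0 < q" unfolding q_def by (rule scale_inv_pos[OF sf s])
    have V: "0 < V" "0 < vol m x q" using vol_pos[OF m] r q by (auto simp: V_def)
    have hs: "0 \<le> h s x y" "h T x y \<le> h s x y"
      using boundary_nonneg[OF bf s] boundary_antimono[OF bf s sT] xy by auto
    note nn = coeff_nonneg[OF m sf bf C\<^sub>0 xy]
    have ps: "b * (h s x y * HK_form m \<Phi> \<Psi> C\<^sub>0 c s x y) \<le> p s x y" using hk \<open>s \<in> I\<close> xy by (simp add: mult.assoc)
    have "q \<le> r" unfolding q_def using scale_inv_le[OF sf s] sT r by (simp add: T_def)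
    then have Vq: "1 / V \<le> 1 / vol m x q" unfolding V_def using vol_mono[OF m] V
      by (intro divide_left_mono) (auto simp: V_def)
    have "jump_coeff m \<Psi> C\<^sub>0 x y * s \<le> HK_form m \<Phi> \<Psi> C\<^sub>0 c s x y"
      unfolding HK_form_def
    proof (rule min.boundedI)
      show "jump_coeff m \<Psi> C\<^sub>0 x y * s \<le> 1 / vol m x (scale_inv \<Phi> s)"
        using nn(3)[OF s sT'] Vq by (simp add: V_def r_def q_def)
      show "jump_coeff m \<Psi> C\<^sub>0 x y * s \<le> C\<^sub>0 * s / (vol m x (dist x y) * \<Psi> (dist x y)) +
          1 / vol m x (scale_inv \<Phi> s) * exp (- c * (dist x y)\<^sup>2 / (scale_inv \<Phi> s)\<^sup>2)"
        using V by (simp add: jump_coeff_def q_def)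
    qed
    then have "b * (h s x y * (jump_coeff m \<Psi> C\<^sub>0 x y * s)) \<le> p s x y"
      using ps pos hs by (meson mult_left_mono order_trans less_imp_le)
    moreover have "a * (h s x y * (jump_coeff m \<Psi> C\<^sub>0 x y * s)) \<le> b * (h s x y * (jump_coeff m \<Psi> C\<^sub>0 x y * s))"
      using a hs nn(1) s by (intro mult_right_mono) auto
    ultimately have jumps: "a * (jump_coeff m \<Psi> C\<^sub>0 x y * (s * h s x y)) \<le> p s x y" by (simp add: mult_ac)
    have "a * diffusive_coeff m \<Phi> h x y \<le> p s x y" if near: "T / M < s"
    proof -
      have "r \<le> Z * q" using Z(2) r near by (simp add: T_def q_def)
      then have "r / q \<le> Z" using q by (simp add: field_simps)
      then have "(r / q)\<^sup>2 \<le> Z\<^sup>2" using r q by (intro power_mono) auto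
      then have "c * (r / q)\<^sup>2 \<le> c * Z\<^sup>2" using pos by (intro mult_left_mono) auto
      then have "c * r\<^sup>2 / q\<^sup>2 \<le> c * Z\<^sup>2" by (simp add: power_divide)
      then have e: "exp (- c * Z\<^sup>2) \<le> exp (- c * r\<^sup>2 / q\<^sup>2)" by simp
      have "exp (- c * Z\<^sup>2) * (1 / V) \<le> HK_form m \<Phi> \<Psi> C\<^sub>0 c s x y"
        unfolding HK_form_def
      proof (rule min.boundedI)
        have "exp (- c * Z\<^sup>2) * (1 / V) \<le> 1 * (1 / V)" using V pos by (intro mult_right_mono) auto
        then show "exp (- c * Z\<^sup>2) * (1 / V) \<le> 1 / vol m x (scale_inv \<Phi> s)" using Vq by (simp add: q_def)
        have "1 / V * exp (- c * Z\<^sup>2) \<le> 1 / vol m x q * exp (- c * r\<^sup>2 / q\<^sup>2)"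
          using V by (intro mult_mono e Vq) auto
        moreover have "0 \<le> C\<^sub>0 * s / (vol m x (dist x y) * \<Psi> (dist x y))"
          using mult_nonneg_nonneg[OF nn(1), of s] s by (simp add: jump_coeff_def)
        ultimately show "exp (- c * Z\<^sup>2) * (1 / V) \<le> C\<^sub>0 * s / (vol m x (dist x y) * \<Psi> (dist x y)) +
          1 / vol m x (scale_inv \<Phi> s) * exp (- c * (dist x y)\<^sup>2 / (scale_inv \<Phi> s)\<^sup>2)"
          by (simp add: q_def r_def mult.commute)
      qed
      then have "h T x y * (exp (- c * Z\<^sup>2) * (1 / V)) \<le> h s x y * HK_form m \<Phi> \<Psi> C\<^sub>0 c s x y"
        using hs V by (intro mult_mono) auto
      then have "b * (h T x y * (exp (- c * Z\<^sup>2) * (1 / V))) \<le> p s x y"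
        using ps pos by (meson mult_left_mono order_trans less_imp_le)
      then show ?thesis by (simp add: a_def diffusive_coeff_def T_def r_def V_def mult_ac)
    qed
    with jumps show ?thesis by (simp add: T_def r_def)
  qed
  with a(1) show "\<exists>a>0. \<forall>x\<in>D. \<forall>y\<in>D. x \<noteq> y \<longrightarrow> (\<forall>s\<in>I. s \<le> \<Phi> (dist x y) \<longrightarrow>
        a * (jump_coeff m \<Psi> C\<^sub>0 x y * (s * h s x y)) \<le> p s x y \<and>
        (\<Phi> (dist x y) / M < s \<longrightarrow> a * diffusive_coeff m \<Phi> h x y \<le> p s x y))"
    by (intro exI[of _ a] conjI ballI impI) simp_all
qed

section \<open>Bounded domains at large times\<close>

text \<open>Constants may be enlarged in upper and diminished in lower profiles because all the terms are
  nonnegative.\<close>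

lemma profile_union:
  fixes m :: "'a::heine_borel measure"
  assumes m: "radon_measure m" "full_support m" and sf: "scale_functions \<Phi> \<Psi>"
    and bf: "boundary_function D \<Phi> h" and C\<^sub>0: "0 \<le> C\<^sub>0" "C\<^sub>0 \<le> 1" and IJ: "I \<subseteq> {0<..}" "J \<subseteq> {0<..}"
  shows upper_profile_union: "upper_profile D m \<Phi> \<Psi> h p C\<^sub>0 I \<Longrightarrow> upper_profile D m \<Phi> \<Psi> h p C\<^sub>0 J \<Longrightarrow>
      upper_profile D m \<Phi> \<Psi> h p C\<^sub>0 (I \<union> J)"
    and lower_profile_union: "lower_profile D m \<Phi> \<Psi> h p C\<^sub>0 I \<Longrightarrow> lower_profile D m \<Phi> \<Psi> h p C\<^sub>0 J \<Longrightarrow>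
      lower_profile D m \<Phi> \<Psi> h p C\<^sub>0 (I \<union> J)"
proof -
  note nn = coeff_nonneg[OF m sf bf C\<^sub>0]
  have hs: "0 \<le> s * h s x y" if "s \<in> I \<union> J" "x \<in> D" "y \<in> D" for s x y
    using that IJ boundary_nonneg[OF bf, of s x y] by auto
  have weaken: "q \<le> a * X" if "q \<le> b * X" "b \<le> a" "0 \<le> X" for q a b X :: real
    using that by (meson mult_right_mono order_trans)
  have strengthen: "a * X \<le> q" if "b * X \<le> q" "a \<le> b" "0 \<le> X" for q a b X :: real
    using that by (meson mult_right_mono order_trans)
  show "upper_profile D m \<Phi> \<Psi> h p C\<^sub>0 (I \<union> J)"
    if U: "upper_profile D m \<Phi> \<Psi> h p C\<^sub>0 I" "upper_profile D m \<Phi> \<Psi> h p C\<^sub>0 J"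
    unfolding upper_profile_def
  proof (intro allI impI)
    fix k :: real assume k: "0 < k"
    obtain A where A: "0 < A" "\<forall>x\<in>D. \<forall>y\<in>D. x \<noteq> y \<longrightarrow> (\<forall>s\<in>I.
        (s < \<Phi> (dist x y) \<longrightarrow> p s x y \<le> A * (jump_coeff m \<Psi> C\<^sub>0 x y * (s * h s x y)
                + diffusive_coeff m \<Phi> h x y * (s / \<Phi> (dist x y)) powr k)) \<and>
        (\<Phi> (dist x y) \<le> s \<longrightarrow> p s x y \<le> A * diffusive_coeff m \<Phi> h x y))"
      using U(1)[unfolded upper_profile_def, rule_format, OF k] by (elim exE conjE)
    obtain B where B: "0 < B" "\<forall>x\<in>D. \<forall>y\<in>D. x \<noteq> y \<longrightarrow> (\<forall>s\<in>J.
        (s < \<Phi> (dist x y) \<longrightarrow> p s x y \<le> B * (jump_coeff m \<Psi> C\<^sub>0 x y * (s * h s x y)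
                + diffusive_coeff m \<Phi> h x y * (s / \<Phi> (dist x y)) powr k)) \<and>
        (\<Phi> (dist x y) \<le> s \<longrightarrow> p s x y \<le> B * diffusive_coeff m \<Phi> h x y))"
      using U(2)[unfolded upper_profile_def, rule_format, OF k] by (elim exE conjE)
    have "(s < \<Phi> (dist x y) \<longrightarrow> p s x y \<le> (A + B) * (jump_coeff m \<Psi> C\<^sub>0 x y * (s * h s x y)
                + diffusive_coeff m \<Phi> h x y * (s / \<Phi> (dist x y)) powr k)) \<and>
        (\<Phi> (dist x y) \<le> s \<longrightarrow> p s x y \<le> (A + B) * diffusive_coeff m \<Phi> h x y)"
      if xy: "x \<in> D" "y \<in> D" "x \<noteq> y" and s: "s \<in> I \<union> J" for x y s
    proof -
      have X: "0 \<le> jump_coeff m \<Psi> C\<^sub>0 x y * (s * h s x y) + diffusive_coeff m \<Phi> h x y * (s / \<Phi> (dist x y)) powr k"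
        by (intro add_nonneg_nonneg mult_nonneg_nonneg[OF nn(1)] mult_nonneg_nonneg[OF nn(2)] hs xy s powr_ge_zero)
      have le: "A \<le> A + B" "B \<le> A + B" using A(1) B(1) by auto
      from s show ?thesis
      proof
        assume "s \<in> I"
        then show ?thesis using A(2) xy weaken[OF _ le(1) X] weaken[OF _ le(1) nn(2)[OF xy]] by blast
      next
        assume "s \<in> J"
        then show ?thesis using B(2) xy weaken[OF _ le(2) X] weaken[OF _ le(2) nn(2)[OF xy]] by blast
      qed
    qed
    then show "\<exists>A>0. \<forall>x\<in>D. \<forall>y\<in>D. x \<noteq> y \<longrightarrow> (\<forall>s\<in>I \<union> J.
        (s < \<Phi> (dist x y) \<longrightarrow> p s x y \<le> A * (jump_coeff m \<Psi> C\<^sub>0 x y * (s * h s x y)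
                + diffusive_coeff m \<Phi> h x y * (s / \<Phi> (dist x y)) powr k)) \<and>
        (\<Phi> (dist x y) \<le> s \<longrightarrow> p s x y \<le> A * diffusive_coeff m \<Phi> h x y))"
      using A(1) B(1) by (intro exI[of _ "A + B"] conjI ballI impI) simp_all
  qed
  show "lower_profile D m \<Phi> \<Psi> h p C\<^sub>0 (I \<union> J)"
    if L: "lower_profile D m \<Phi> \<Psi> h p C\<^sub>0 I" "lower_profile D m \<Phi> \<Psi> h p C\<^sub>0 J"
    unfolding lower_profile_def
  proof (intro allI impI)
    fix M :: real assume M: "1 < M"
    obtain a where a: "0 < a" "\<forall>x\<in>D. \<forall>y\<in>D. x \<noteq> y \<longrightarrow> (\<forall>s\<in>I. s \<le> \<Phi> (dist x y) \<longrightarrow>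
        a * (jump_coeff m \<Psi> C\<^sub>0 x y * (s * h s x y)) \<le> p s x y \<and>
        (\<Phi> (dist x y) / M < s \<longrightarrow> a * diffusive_coeff m \<Phi> h x y \<le> p s x y))"
      using L(1)[unfolded lower_profile_def, rule_format, OF M] by (elim exE conjE)
    obtain b where b: "0 < b" "\<forall>x\<in>D. \<forall>y\<in>D. x \<noteq> y \<longrightarrow> (\<forall>s\<in>J. s \<le> \<Phi> (dist x y) \<longrightarrow>
        b * (jump_coeff m \<Psi> C\<^sub>0 x y * (s * h s x y)) \<le> p s x y \<and>
        (\<Phi> (dist x y) / M < s \<longrightarrow> b * diffusive_coeff m \<Phi> h x y \<le> p s x y))"
      using L(2)[unfolded lower_profile_def, rule_format, OF M] by (elim exE conjE)
    have "min a b * (jump_coeff m \<Psi> C\<^sub>0 x y * (s * h s x y)) \<le> p s x y \<and>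
        (\<Phi> (dist x y) / M < s \<longrightarrow> min a b * diffusive_coeff m \<Phi> h x y \<le> p s x y)"
      if xy: "x \<in> D" "y \<in> D" "x \<noteq> y" and s: "s \<in> I \<union> J" and sT: "s \<le> \<Phi> (dist x y)" for x y s
    proof -
      have X: "0 \<le> jump_coeff m \<Psi> C\<^sub>0 x y * (s * h s x y)"
        by (intro mult_nonneg_nonneg[OF nn(1)] hs xy s)
      from s show ?thesis
      proof
        assume "s \<in> I"
        then show ?thesis using a(2) xy sT strengthen[OF _ min.cobounded1[of a b] X]
            strengthen[OF _ min.cobounded1[of a b] nn(2)[OF xy]] by blast
      next
        assume "s \<in> J"
        then show ?thesis using b(2) xy sT strengthen[OF _ min.cobounded2[of a b] X]
            strengthen[OF _ min.cobounded2[of a b] nn(2)[OF xy]] by blast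
      qed
    qed
    then show "\<exists>a>0. \<forall>x\<in>D. \<forall>y\<in>D. x \<noteq> y \<longrightarrow> (\<forall>s\<in>I \<union> J. s \<le> \<Phi> (dist x y) \<longrightarrow>
        a * (jump_coeff m \<Psi> C\<^sub>0 x y * (s * h s x y)) \<le> p s x y \<and>
        (\<Phi> (dist x y) / M < s \<longrightarrow> a * diffusive_coeff m \<Phi> h x y \<le> p s x y))"
      using a(1) b(1) by (intro exI[of _ "min a b"] conjI ballI impI) simp_all
  qed
qed

text \<open>On a bounded domain everything is bounded: \<open>\<Phi> (dist x y) \<le> K\<close>, so \<open>h 1 x y\<close> is at most a constant
  times \<open>h\<close> at time \<open>\<Phi> (dist x y)\<close>; the volumes have an upper bound; and the powers of
  \<open>s / \<Phi> (dist x y)\<close> are bounded below for \<open>s > 1\<close>.\<close>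

lemma upper_profile_large_times:
  fixes m :: "'a::heine_borel measure"
  assumes m: "radon_measure m" "full_support m" and sf: "scale_functions \<Phi> \<Psi>"
    and bf: "boundary_function D \<Phi> h" and C\<^sub>0: "0 \<le> C\<^sub>0" "C\<^sub>0 \<le> 1" and D: "bounded D"
    and b: "0 < b" and p: "\<And>s x y. 1 < s \<Longrightarrow> x \<in> D \<Longrightarrow> y \<in> D \<Longrightarrow> p s x y \<le> b * h 1 x y"
  shows "upper_profile D m \<Phi> \<Psi> h p C\<^sub>0 {1<..}"
  unfolding upper_profile_def
proof (intro allI impI)
  fix k :: real assume k: "0 < k"
  obtain c1 \<gamma> where h2: "0 < c1" "0 \<le> \<gamma>" "\<forall>x\<in>D. \<forall>y\<in>D. \<forall>s>0. s \<le> \<Phi> (dist x y) \<longrightarrow>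
    h s x y \<le> c1 * (\<Phi> (dist x y) / s) powr \<gamma> * h (\<Phi> (dist x y)) x y"
    using boundary_doubling[OF sf bf] by (elim exE conjE)
  define K where "K = max 1 (\<Phi> (diameter D))"
  have K: "1 \<le> K" "\<Phi> (dist x y) \<le> K" if "x \<in> D" "y \<in> D" for x y
    using scale_dist_le_diameter[OF sf that D] by (auto simp: K_def)
  have K1: "1 \<le> K" by (simp add: K_def)
  define x0 where "x0 = (SOME x. x \<in> D)"
  define vmax where "vmax = vol m x0 (2 * diameter D + 1)"
  have dD: "0 \<le> diameter D" by (rule diameter_ge_0[OF D])
  have vmax: "0 < vmax" unfolding vmax_def using dD by (intro vol_pos[OF m]) simp
  have vol_le: "vol m x (dist x y) \<le> vmax" if "x \<in> D" "y \<in> D" for x y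
    unfolding vmax_def
  proof (rule vol_ball_subset[OF m], rule subsetI)
    fix z assume "z \<in> ball x (dist x y)"
    moreover have "x0 \<in> D" unfolding x0_def using that by (rule_tac someI)
    then have "dist x0 x \<le> diameter D" using D that by (intro diameter_bounded_bound)
    moreover have "dist x y \<le> diameter D" using D that by (intro diameter_bounded_bound)
    ultimately show "z \<in> ball x0 (2 * diameter D + 1)"
      using dist_triangle[of x0 z x] by simp
  qed
  define c where "c = max 1 (c1 * K powr \<gamma>)"
  have c: "1 \<le> c" "c1 * K powr \<gamma> \<le> c" by (auto simp: c_def)
  define A where "A = b * c * vmax * K powr k"
  have A: "0 < A" using b c vmax K1 by (simp add: A_def)
  have "(s < \<Phi> (dist x y) \<longrightarrow> p s x y \<le> A * (jump_coeff m \<Psi> C\<^sub>0 x y * (s * h s x y)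
                + diffusive_coeff m \<Phi> h x y * (s / \<Phi> (dist x y)) powr k)) \<and>
        (\<Phi> (dist x y) \<le> s \<longrightarrow> p s x y \<le> A * diffusive_coeff m \<Phi> h x y)"
    if xy: "x \<in> D" "y \<in> D" "x \<noteq> y" and s: "1 < s" for x y s
  proof -
    define T V where "T = \<Phi> (dist x y)" and "V = vol m x (dist x y)"
    have T: "0 < T" "T \<le> K" unfolding T_def using scale_pos[OF sf] xy K by auto
    have V: "0 < V" "V \<le> vmax" unfolding V_def using vol_pos[OF m] vol_le xy by auto
    have hT: "0 \<le> h T x y" using boundary_nonneg[OF bf T(1)] xy by auto
    note nn = coeff_nonneg[OF m sf bf C\<^sub>0 xy]
    have h1: "h 1 x y \<le> c * h T x y"
    proof (cases "T \<le> 1")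
      case True
      then have "h 1 x y \<le> 1 * h T x y" using boundary_antimono[OF bf T(1) True] xy by simp
      also have "\<dots> \<le> c * h T x y" using c hT by (intro mult_right_mono) auto
      finally show ?thesis .
    next
      case False
      then have "h 1 x y \<le> c1 * T powr \<gamma> * h T x y"
        using h2(3)[rule_format, OF xy(1,2), of 1] by (simp add: T_def)
      also have "\<dots> \<le> c1 * K powr \<gamma> * h T x y"
        using h2 T hT by (intro mult_right_mono mult_left_mono powr_mono2) auto
      also have "\<dots> \<le> c * h T x y" using c hT by (intro mult_right_mono) auto
      finally show ?thesis .
    qed
    have "h T x y * 1 \<le> h T x y * (vmax / V)" using hT V by (intro mult_left_mono) auto
    then have hV: "h T x y \<le> vmax * diffusive_coeff m \<Phi> h x y"
      by (simp add: diffusive_coeff_def T_def V_def mult.commute)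
    have "p s x y \<le> b * h 1 x y" using p[OF s xy(1,2)] .
    also have "\<dots> \<le> b * (c * (vmax * diffusive_coeff m \<Phi> h x y))"
      using b c h1 hV by (intro mult_left_mono order_trans[OF h1]) auto
    also have "\<dots> = b * c * vmax * diffusive_coeff m \<Phi> h x y" by simp
    finally have ps: "p s x y \<le> b * c * vmax * diffusive_coeff m \<Phi> h x y" .
    have pos: "0 \<le> b * c * vmax * diffusive_coeff m \<Phi> h x y" using b c vmax nn(2) by simp
    have "p s x y \<le> A * (jump_coeff m \<Psi> C\<^sub>0 x y * (s * h s x y) + diffusive_coeff m \<Phi> h x y * (s / T) powr k)"
    proof -
      have "1 \<le> K * (s / T)"
      proof -
        have "T * 1 \<le> K * s" using T s by (intro mult_mono) auto
        then show ?thesis using T by (simp add: field_simps)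
      qed
      then have "1 \<le> (K * (s / T)) powr k" using k by (simp add: ge_one_powr_ge_zero)
      also have "\<dots> = K powr k * (s / T) powr k" using K1 T s by (intro powr_mult)
      finally have "b * c * vmax * diffusive_coeff m \<Phi> h x y * 1 \<le> b * c * vmax * diffusive_coeff m \<Phi> h x y * (K powr k * (s / T) powr k)"
        using pos by (intro mult_left_mono)
      moreover have "0 \<le> A * (jump_coeff m \<Psi> C\<^sub>0 x y * (s * h s x y))"
        using A nn(1) s boundary_nonneg[OF bf _ xy(1,2), of s] by simp
      ultimately show ?thesis using ps by (simp add: A_def algebra_simps)
    qed
    moreover have "p s x y \<le> A * diffusive_coeff m \<Phi> h x y"
    proof -
      have "b * c * vmax * diffusive_coeff m \<Phi> h x y * 1 \<le> b * c * vmax * diffusive_coeff m \<Phi> h x y * K powr k"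
        using pos K1 k by (intro mult_left_mono) (auto simp: ge_one_powr_ge_zero)
      then show ?thesis using ps by (simp add: A_def mult_ac)
    qed
    ultimately show ?thesis by (simp add: T_def)
  qed
  with A show "\<exists>A>0. \<forall>x\<in>D. \<forall>y\<in>D. x \<noteq> y \<longrightarrow> (\<forall>s\<in>{1<..}.
        (s < \<Phi> (dist x y) \<longrightarrow> p s x y \<le> A * (jump_coeff m \<Psi> C\<^sub>0 x y * (s * h s x y)
                + diffusive_coeff m \<Phi> h x y * (s / \<Phi> (dist x y)) powr k)) \<and>
        (\<Phi> (dist x y) \<le> s \<longrightarrow> p s x y \<le> A * diffusive_coeff m \<Phi> h x y))"
    by (intro exI[of _ A] conjI ballI impI) simp_all
qed

text \<open>Only times between \<open>1\<close> and \<open>\<Phi> (dist x y)\<close> are concerned. So the exponential decay is bounded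
  below, and \<open>dist x y\<close> is at least the diffusive radius at time \<open>1\<close>, for which the volumes of balls
  centred in \<open>D\<close> have a positive lower bound by doubling.\<close>

lemma lower_profile_large_times:
  fixes m :: "'a::heine_borel measure"
  assumes m: "radon_measure m" "full_support m" "0 < R\<^sub>E" "volume_doubling m R\<^sub>E" and sf: "scale_functions \<Phi> \<Psi>"
    and bf: "boundary_function D \<Phi> h" and C\<^sub>0: "0 \<le> C\<^sub>0" "C\<^sub>0 \<le> 1" and D: "bounded D"
    and b: "0 < b" "0 < \<mu>"
    and p: "\<And>s x y. 1 < s \<Longrightarrow> x \<in> D \<Longrightarrow> y \<in> D \<Longrightarrow> b * (exp (- \<mu> * s) * h 1 x y) \<le> p s x y"
  shows "lower_profile D m \<Phi> \<Psi> h p C\<^sub>0 {1<..}"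
  unfolding lower_profile_def
proof (intro allI impI)
  fix M :: real assume M: "1 < M"
  define K where "K = \<Phi> (diameter D)"
  define r1 where "r1 = scale_inv \<Phi> 1"
  have r1: "0 < r1" unfolding r1_def by (rule scale_inv_pos[OF sf]) simp
  define x0 where "x0 = (SOME x. x \<in> D)"
  define R where "R = diameter D + r1"
  have R: "r1 \<le> R" using diameter_ge_0[OF D] by (simp add: R_def)
  obtain C d where C: "0 < C" "0 < d" "\<forall>x r S. 0 < r \<longrightarrow> r \<le> S \<longrightarrow> S \<le> R \<or> R\<^sub>E = \<infinity> \<longrightarrow>
    vol m x S \<le> C * (S / r) powr d * vol m x r"
    using vol_doubling_upper[OF m, of R] by (elim exE conjE)
  define vmin where "vmin = vol m x0 r1 / (C * (R / r1) powr d)"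
  have vmin: "0 < vmin" unfolding vmin_def using C r1 R vol_pos[OF m(1,2) r1] by simp
  have vol_ge: "vmin \<le> vol m x r1" if "x \<in> D" for x
  proof -
    have "x0 \<in> D" unfolding x0_def using that by (rule someI)
    then have "dist x x0 \<le> diameter D" using D that by (intro diameter_bounded_bound)
    then have "ball x0 r1 \<subseteq> ball x R"
      unfolding R_def using dist_triangle[of x _ x0] by (auto simp: subset_iff) (smt (verit))
    then have "vol m x0 r1 \<le> vol m x R" by (rule vol_ball_subset[OF m(1,2)])
    also have "\<dots> \<le> C * (R / r1) powr d * vol m x r1" using C(3) r1 R by blast
    finally show ?thesis unfolding vmin_def using C r1 R by (simp add: pos_divide_le_eq mult_ac)
  qed
  define a where "a = b * exp (- \<mu> * K) * vmin"
  have a: "0 < a" using b vmin by (simp add: a_def)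
  have "a * (jump_coeff m \<Psi> C\<^sub>0 x y * (s * h s x y)) \<le> p s x y \<and>
        (\<Phi> (dist x y) / M < s \<longrightarrow> a * diffusive_coeff m \<Phi> h x y \<le> p s x y)"
    if xy: "x \<in> D" "y \<in> D" "x \<noteq> y" and s: "1 < s" and sT: "s \<le> \<Phi> (dist x y)" for x y s
  proof -
    define V where "V = vol m x (dist x y)"
    have "r1 \<le> dist x y" unfolding r1_def using s sT by (intro scale_inv_le[OF sf]) auto
    then have V: "vmin \<le> V" unfolding V_def using vol_mono[OF m(1,2)] vol_ge[OF xy(1)] order_trans by blast
    have hs: "0 \<le> h s x y" "h s x y \<le> h 1 x y" "h (\<Phi> (dist x y)) x y \<le> h s x y"
      using boundary_nonneg[OF bf, of s] boundary_antimono[OF bf, of 1 s] boundary_antimono[OF bf _ sT] xy s by auto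
    note nn = coeff_nonneg[OF m(1,2) sf bf C\<^sub>0 xy]
    have "s \<le> K" unfolding K_def using scale_dist_le_diameter[OF sf xy(1,2) D] sT by simp
    then have e: "exp (- \<mu> * K) \<le> exp (- \<mu> * s)" using b by simp
    have main: "b * (exp (- \<mu> * K) * h s x y) \<le> p s x y"
    proof -
      have "b * (exp (- \<mu> * K) * h s x y) \<le> b * (exp (- \<mu> * s) * h 1 x y)"
        using b hs by (intro mult_left_mono mult_mono e) auto
      also have "\<dots> \<le> p s x y" by (rule p[OF s xy(1,2)])
      finally show ?thesis .
    qed
    have *: "a * (X / V) \<le> p s x y" if "X \<le> h s x y" "0 \<le> X" for X
    proof -
      have "vmin * (X / V) \<le> V * (X / V)" using V vmin that by (intro mult_right_mono) auto
      also have "\<dots> = X" using V vmin by simp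
      finally have "vmin * (X / V) \<le> X" .
      then have "vmin * (X / V) \<le> h s x y" using that by simp
      then have "b * (exp (- \<mu> * K) * (vmin * (X / V))) \<le> b * (exp (- \<mu> * K) * h s x y)"
        using b by (intro mult_left_mono) auto
      then show ?thesis using main by (simp add: a_def mult.assoc)
    qed
    have "jump_coeff m \<Psi> C\<^sub>0 x y * s * h s x y \<le> 1 / V * h s x y"
      unfolding V_def using hs s by (intro mult_right_mono nn(3) sT) auto
    then have "a * (jump_coeff m \<Psi> C\<^sub>0 x y * (s * h s x y)) \<le> a * (h s x y / V)"
      using a by (intro mult_left_mono) (auto simp: mult.assoc)
    also have "\<dots> \<le> p s x y" by (rule *) (use hs in auto)
    finally have "a * (jump_coeff m \<Psi> C\<^sub>0 x y * (s * h s x y)) \<le> p s x y" .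
    moreover have "a * diffusive_coeff m \<Phi> h x y \<le> p s x y"
      unfolding diffusive_coeff_def V_def[symmetric]
      by (rule *) (use hs boundary_nonneg[OF bf, of "\<Phi> (dist x y)"] xy s sT in auto)
    ultimately show ?thesis by simp
  qed
  with a show "\<exists>a>0. \<forall>x\<in>D. \<forall>y\<in>D. x \<noteq> y \<longrightarrow> (\<forall>s\<in>{1<..}. s \<le> \<Phi> (dist x y) \<longrightarrow>
        a * (jump_coeff m \<Psi> C\<^sub>0 x y * (s * h s x y)) \<le> p s x y \<and>
        (\<Phi> (dist x y) / M < s \<longrightarrow> a * diffusive_coeff m \<Phi> h x y \<le> p s x y))"
    by (intro exI[of _ a] conjI ballI impI) simp_all
qed

section \<open>The jump kernel\<close>

text \<open>The exponent \<open>k\<close> of the upper profile is taken as \<open>\<beta> + 1\<close>, where \<open>\<beta>\<close> is the upper exponent of the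
  tail, and the parameter \<open>M\<close> of the lower profile as the factor of \<open>poly_tail_halving\<close>.\<close>

lemma jump_kernel_estimate_if_profiles:
  fixes m :: "'a::heine_borel measure"
  assumes m: "radon_measure m" "full_support m" and sf: "scale_functions \<Phi> \<Psi>"
    and bf: "boundary_function D \<Phi> h" and C\<^sub>0: "0 \<le> C\<^sub>0" "C\<^sub>0 \<le> 1"
    and levy: "levy_measure \<nu>" and poly: "poly_tail R\<^sub>1 \<nu>"
    and R\<^sub>1: "\<And>x y. x \<in> D \<Longrightarrow> y \<in> D \<Longrightarrow> ereal (\<Phi> (dist x y)) < R\<^sub>1"
    and upper: "upper_profile D m \<Phi> \<Psi> h p C\<^sub>0 {0<..}" and lower: "lower_profile D m \<Phi> \<Psi> h p C\<^sub>0 {0<..}"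
  shows "\<exists>c\<^sub>1>0. \<exists>c\<^sub>2>0. \<forall>x\<in>D. \<forall>y\<in>D. x \<noteq> y \<longrightarrow>
    (let r = dist x y;
         G = ennreal (C\<^sub>0 / (vol m x r * \<Psi> r)) * B_star \<Phi> \<nu> h x y
             + ennreal (h (\<Phi> r) x y * (tail \<nu> (\<Phi> r) / vol m x r))
     in ennreal c\<^sub>1 * G \<le> jump_kernel p \<nu> x y \<and> jump_kernel p \<nu> x y \<le> ennreal c\<^sub>2 * G)"
proof -
  obtain M where M: "1 < M" "\<forall>s>0. ereal s < R\<^sub>1 \<longrightarrow> 2 * tail \<nu> s \<le> tail \<nu> (s / M)"
    using poly_tail_halving[OF poly] by (elim exE conjE)
  obtain c \<beta> where c: "0 < c" "0 < \<beta>" "\<forall>r R. 0 < r \<longrightarrow> r \<le> R \<longrightarrow> ereal R < R\<^sub>1 \<longrightarrow>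
    tail \<nu> r \<le> c * (R / r) powr \<beta> * tail \<nu> R"
    using poly_tail_upper[OF poly] by (elim exE conjE)
  obtain a where a: "0 < a" "\<forall>x\<in>D. \<forall>y\<in>D. x \<noteq> y \<longrightarrow> (\<forall>s\<in>{0<..}. s \<le> \<Phi> (dist x y) \<longrightarrow>
        a * (jump_coeff m \<Psi> C\<^sub>0 x y * (s * h s x y)) \<le> p s x y \<and>
        (\<Phi> (dist x y) / M < s \<longrightarrow> a * diffusive_coeff m \<Phi> h x y \<le> p s x y))"
    using lower[unfolded lower_profile_def, rule_format, OF M(1)] by (elim exE conjE)
  have k: "0 < \<beta> + 1" using c by simp
  obtain A where A: "0 < A" "\<forall>x\<in>D. \<forall>y\<in>D. x \<noteq> y \<longrightarrow> (\<forall>s\<in>{0<..}.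
        (s < \<Phi> (dist x y) \<longrightarrow> p s x y \<le> A * (jump_coeff m \<Psi> C\<^sub>0 x y * (s * h s x y)
                + diffusive_coeff m \<Phi> h x y * (s / \<Phi> (dist x y)) powr (\<beta> + 1))) \<and>
        (\<Phi> (dist x y) \<le> s \<longrightarrow> p s x y \<le> A * diffusive_coeff m \<Phi> h x y))"
    using upper[unfolded upper_profile_def, rule_format, OF k] by (elim exE conjE)
  define c\<^sub>2 where "c\<^sub>2 = A * (1 + 2 powr (\<beta> + 1) * c + c * 2 powr \<beta>)"
  have c\<^sub>2: "0 < c\<^sub>2" using A(1) c by (auto simp: c\<^sub>2_def intro!: mult_pos_pos add_pos_nonneg)
  have est: "let r = dist x y;
         G = ennreal (C\<^sub>0 / (vol m x r * \<Psi> r)) * B_star \<Phi> \<nu> h x y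
             + ennreal (h (\<Phi> r) x y * (tail \<nu> (\<Phi> r) / vol m x r))
     in ennreal (a / (2 * M)) * G \<le> jump_kernel p \<nu> x y \<and> jump_kernel p \<nu> x y \<le> ennreal c\<^sub>2 * G"
    if xy: "x \<in> D" "y \<in> D" "x \<noteq> y" for x y
  proof -
    define T where "T = \<Phi> (dist x y)"
    define e where "e = jump_coeff m \<Psi> C\<^sub>0 x y"
    define v where "v = diffusive_coeff m \<Phi> h x y"
    have T: "0 < T" "ereal T < R\<^sub>1" unfolding T_def using scale_pos[OF sf] R\<^sub>1 xy by auto
    have ev: "0 \<le> e" "0 \<le> v" unfolding e_def v_def using coeff_nonneg(1,2)[OF m sf bf C\<^sub>0 xy] by auto
    have anti: "h t x y \<le> h s x y" if "0 < s" "s \<le> t" for s t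
      using boundary_antimono[OF bf that] xy by blast
    have bdd: "0 \<le> h s x y \<and> h s x y \<le> 1" if "0 < s" for s
      using boundary_nonneg[OF bf that] boundary_le_1[OF bf that] xy by blast
    have lt: "ereal s < R\<^sub>1" if "s \<le> T" for s
      using that T(2) by (meson ereal_less_eq(3) le_less_trans)
    let ?G = "ennreal e * (\<integral>\<^sup>+ s\<in>{0<..<T}. ennreal (h s x y * tail \<nu> s) \<partial>lborel) + ennreal (v * tail \<nu> T)"
    have "(\<integral>\<^sup>+ s\<in>{0<..}. ennreal (p s x y) \<partial>\<nu>) \<le> ennreal c\<^sub>2 * ?G"
      unfolding c\<^sub>2_def
    proof (rule jump_integral_upper[OF levy c(1,2) T(1) ev A(1) _ anti bdd])
      show "tail \<nu> r \<le> c * (T / r) powr \<beta> * tail \<nu> T" if "0 < r" "r \<le> T" for r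
        using c(3) that T(2) by blast
      show "p s x y \<le> A * (e * (s * h s x y) + v * (s / T) powr (\<beta> + 1))" if "0 < s" "s < T" for s
        using A(2) xy that unfolding e_def v_def T_def by simp
      show "p s x y \<le> A * v" if "T \<le> s" for s
        using A(2) xy that T(1) unfolding v_def T_def by simp
    qed
    moreover have "ennreal (a / (2 * M)) * ?G \<le> (\<integral>\<^sup>+ s\<in>{0<..}. ennreal (p s x y) \<partial>\<nu>)"
    proof (rule jump_integral_lower[OF levy T(1) ev a(1) M(1) _ anti bdd])
      show "2 * tail \<nu> s \<le> tail \<nu> (s / M)" if "0 < s" "s \<le> T" for s
        using M(2) that lt by blast
      show "a * (e * (s * h s x y)) \<le> p s x y" if "0 < s" "s \<le> T" for s
        using a(2) xy that unfolding e_def T_def by simp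
      show "a * v \<le> p s x y" if "T / M < s" "s \<le> T" for s
      proof -
        have "0 < s" using that(1) T(1) M(1) by (smt (verit) divide_pos_pos)
        then show ?thesis using a(2) xy that unfolding v_def T_def by simp
      qed
    qed
    ultimately show ?thesis
      unfolding Let_def jump_kernel_def B_star_def
      by (simp add: e_def v_def T_def jump_coeff_def diffusive_coeff_def)
  qed
  have c1: "0 < a / (2 * M)" using a(1) M(1) by simp
  show ?thesis
    by (rule exI[of _ "a / (2 * M)"], rule conjI[OF c1], rule exI[of _ c\<^sub>2], rule conjI[OF c\<^sub>2],
        intro ballI impI est)
qed

theorem theorem4p1:
  fixes m :: "'a::{heine_borel, second_countable_topology} measure"
    and D :: "'a set"
    and W :: "'w measure" and P :: "'a option \<Rightarrow> 'w measure"
    and Y :: "ennreal \<Rightarrow> 'w \<Rightarrow> 'a option" and S :: "real \<Rightarrow> 'w \<Rightarrow> real"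
    and \<nu> :: "real measure"
    and \<Phi> \<Psi> :: "real \<Rightarrow> real"
    and h p :: "real \<Rightarrow> 'a \<Rightarrow> 'a \<Rightarrow> real"
    and R\<^sub>E R\<^sub>1 :: ereal and C\<^sub>0 :: real
  assumes "radon_measure m" and "full_support m"
    and "0 < R\<^sub>E" and "volume_doubling m R\<^sub>E"
    and "open D" and "D \<noteq> UNIV"
    and "hunt_process D W P Y"
    and "\<forall>z\<in>insert None (Some ` D).
           driftless_subordinator (P z) S \<nu> \<and> independent_processes D (P z) Y S"
    and "heat_kernel D m W P Y p"
    and "scale_functions \<Phi> \<Psi>"
    and "boundary_function D \<Phi> h"
    and "C\<^sub>0 \<in> {0, 1}"
    and "0 < R\<^sub>1"
    and "(poly_tail R\<^sub>1 \<nu> \<and> HK_B D m \<Phi> \<Psi> h p C\<^sub>0 \<and> scale_diam \<Phi> D < R\<^sub>1 / 8) \<or>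
         (poly_tail \<infinity> \<nu> \<and> HK_U D m R\<^sub>E \<Phi> \<Psi> h p C\<^sub>0)"
  shows "\<exists>c\<^sub>1>0. \<exists>c\<^sub>2>0. \<forall>x\<in>D. \<forall>y\<in>D. x \<noteq> y \<longrightarrow>
    (let r = dist x y;
         G = ennreal (C\<^sub>0 / (vol m x r * \<Psi> r)) * B_star \<Phi> \<nu> h x y
             + ennreal (h (\<Phi> r) x y * (tail \<nu> (\<Phi> r) / vol m x r))
     in ennreal c\<^sub>1 * G \<le> jump_kernel p \<nu> x y \<and> jump_kernel p \<nu> x y \<le> ennreal c\<^sub>2 * G)"
proof -
  have C\<^sub>0: "0 \<le> C\<^sub>0" "C\<^sub>0 \<le> 1" using assms(12) by auto
  have levy: "levy_measure \<nu>" using assms(8) by (simp add: driftless_subordinator_def)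
  note profiles = assms(1,2,10,11) C\<^sub>0
  from assms(14) show ?thesis
  proof
    assume B: "poly_tail R\<^sub>1 \<nu> \<and> HK_B D m \<Phi> \<Psi> h p C\<^sub>0 \<and> scale_diam \<Phi> D < R\<^sub>1 / 8"
    then have D: "bounded D" and hk: "HK_estimate D m \<Phi> \<Psi> h p C\<^sub>0 {0<..1}" by (auto simp: HK_B_def)
    from B obtain \<mu> b\<^sub>1 b\<^sub>2 where b: "0 < \<mu>" "0 < b\<^sub>1" "0 < b\<^sub>2"
      and large: "\<forall>t\<ge>1. \<forall>x\<in>D. \<forall>y\<in>D. b\<^sub>1 * (exp (- \<mu> * t) * h 1 x y) \<le> p t x y \<and>
        p t x y \<le> b\<^sub>2 * (exp (- \<mu> * t) * h 1 x y)"
      unfolding HK_B_def by (elim exE conjE)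
    obtain C d where C: "0 < C" "0 < d" "\<forall>x r R. 0 < r \<longrightarrow> r \<le> R \<longrightarrow> R \<le> diameter D \<or> R\<^sub>E = \<infinity> \<longrightarrow>
        vol m x R \<le> C * (R / r) powr d * vol m x r"
      using vol_doubling_upper[OF assms(1-4), of "diameter D"] by (elim exE conjE)
    have doubling: "vol m x (dist x y) \<le> C * (dist x y / r) powr d * vol m x r"
      if "x \<in> D" "y \<in> D" "0 < r" "r \<le> dist x y" for x y r
      using C(3) that diameter_bounded_bound[OF D that(1,2)] by blast
    have large_upper: "p s x y \<le> b\<^sub>2 * h 1 x y" if "1 < s" "x \<in> D" "y \<in> D" for s x y
    proof -
      have "p s x y \<le> b\<^sub>2 * (exp (- \<mu> * s) * h 1 x y)" using large that by simp
      also have "\<dots> \<le> b\<^sub>2 * (1 * h 1 x y)"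
        using b that boundary_nonneg[OF assms(11), of 1 x y] by (intro mult_left_mono mult_right_mono) auto
      finally show ?thesis by simp
    qed
    \<comment> \<open>Small times are governed by the two-sided heat kernel estimate, large ones by the exponential decay.\<close>
    have times: "{0<..1} \<union> {1<..} = {0::real<..}" by auto
    have "upper_profile D m \<Phi> \<Psi> h p C\<^sub>0 ({0<..1} \<union> {1<..})"
      by (rule upper_profile_union[OF profiles _ _ upper_profile_heat_kernel[OF profiles C(1,2) doubling _ hk]
            upper_profile_large_times[OF profiles D b(3) large_upper]]) auto
    moreover have "lower_profile D m \<Phi> \<Psi> h p C\<^sub>0 ({0<..1} \<union> {1<..})"
    proof (rule lower_profile_union[OF profiles _ _ lower_profile_heat_kernel[OF profiles _ hk]
          lower_profile_large_times[OF assms(1-4,10,11) C\<^sub>0 D b(2,1)]])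
      show "b\<^sub>1 * (exp (- \<mu> * s) * h 1 x y) \<le> p s x y" if "1 < s" "x \<in> D" "y \<in> D" for s x y
        using large that by simp
    qed auto
    moreover have "ereal (\<Phi> (dist x y)) < R\<^sub>1" if "x \<in> D" "y \<in> D" for x y
    proof -
      have "\<Phi> (dist x y) \<le> \<Phi> (diameter D)" by (rule scale_dist_le_diameter[OF assms(10) that D])
      moreover have "0 \<le> \<Phi> (diameter D)"
        using assms(10) diameter_ge_0[OF D] by (simp add: scale_functions_def)
      moreover have "ereal (\<Phi> (diameter D)) < R\<^sub>1 / 8" using B D by (simp add: scale_diam_def)
      ultimately show ?thesis by (cases R\<^sub>1) auto
    qed
    ultimately show ?thesis
      unfolding times using B by (intro jump_kernel_estimate_if_profiles[OF profiles levy, of R\<^sub>1]) auto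
  next
    assume U: "poly_tail \<infinity> \<nu> \<and> HK_U D m R\<^sub>E \<Phi> \<Psi> h p C\<^sub>0"
    then have RE: "R\<^sub>E = \<infinity>" and hk: "HK_estimate D m \<Phi> \<Psi> h p C\<^sub>0 {0<..}" by (auto simp: HK_U_def)
    obtain C d where C: "0 < C" "0 < d" "\<forall>x r R. 0 < r \<longrightarrow> r \<le> R \<longrightarrow> R \<le> 0 \<or> R\<^sub>E = \<infinity> \<longrightarrow>
        vol m x R \<le> C * (R / r) powr d * vol m x r"
      using vol_doubling_upper[OF assms(1-4), of 0] by (elim exE conjE)
    have doubling: "vol m x (dist x y) \<le> C * (dist x y / r) powr d * vol m x r"
      if "x \<in> D" "y \<in> D" "0 < r" "r \<le> dist x y" for x y r
      using C(3) that RE by blast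
    have "upper_profile D m \<Phi> \<Psi> h p C\<^sub>0 {0<..}"
      by (rule upper_profile_heat_kernel[OF profiles C(1,2) doubling subset_refl hk])
    moreover have "lower_profile D m \<Phi> \<Psi> h p C\<^sub>0 {0<..}"
      by (rule lower_profile_heat_kernel[OF profiles subset_refl hk])
    ultimately show ?thesis
      using U by (intro jump_kernel_estimate_if_profiles[OF profiles levy, of "\<infinity>"]) auto
  qed
qed

end
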